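(* Assume the setting and all standing assumptions listed in the context (two-time-scale recursion, regularity of $f,g,\lambda$, time-dependent noise with parameters $\gamma_1,\gamma_2\ge0$, $\gamma_1-\gamma_2\in[-1,\tfrac12)$). Put $$b=1,\qquad a=\frac{2-\gamma_1+\gamma_2}{3}\in(\tfrac12,1],\qquad t=\frac{2+2\gamma_1+\gamma_2}{3},$$ and let the step sizes be $\alpha_k=\dfrac{\alpha}{(k+1+k_0)^a}$, $\beta_k=\dfrac{\beta}{(k+1+k_0)^b}$, where $\alpha,\beta,k_0>0$ satisfy $$\frac{\alpha}{\beta}\ge\max\left\{\frac{4}{\mu_f}\Big(2L_\lambda L_g+\frac{2}{\mu_g}L_\lambda^2L_g^2(L_\lambda+1)^2\Big),\ 2c,\ \frac{\mu_g}{\mu_f},\ 1\right\},\qquad \beta\ge\frac{2}{\mu_g}(2a+t),$$ $$k_0\ge\max\left\{\alpha^{1/a},\ \Big(\frac{\alpha^2}{\beta}\Big)^{1/(2a-1)},\ \frac{1}{2^{1/t}-1},\ \frac{1}{2^{1/(2a)}-1},\ (6C_{\alpha\beta}\alpha^2)^{1/(2a-1)}\right\},$$ with $$\begin{aligned}C_{\alpha\beta}={}&L_f^2+4L_\lambda^2L_g^2\frac{\beta^2}{\alpha^2}+2L_fL_\lambda L_g\frac{\beta}{\alpha}+\frac{2}{\mu_g}L_f^2L_\lambda^2L_g^2(L_\lambda+1)^2\beta+\frac1cL_g^2(L_\lambda+2)\frac{\beta}{\alpha}\\&+4cL_\lambda^2L_g^2(L_\lambda+1)^2\frac{\beta^3}{\alpha^3}+L_g^2(2L_\lambda^2+L_\lambda+3)\frac{\beta^2}{\alpha^2}.\end{aligned}$$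 Define $$C_2'=2c\alpha\beta\,\Gamma_{11}'+\frac{\beta^3}{\alpha^2}\Big(c\Big(\frac{2}{\mu_f}L_\lambda^2+\frac{2}{\mu_f}L_f^2L_\lambda^2+2L_\lambda^2\Big)+1\Big)\Gamma_{22}'.$$ Then there exists $M$ with $$M\ge\max\left\{3k_0^tV_0,\ \frac3aC_2'\right\},$$ and for such $M$ one has, for all integers $k\ge0$, $$\mathbb{E}[V_k]\le\frac{M}{(k+k_0)^t}.$$
   Context: Norms and inner products are Euclidean. Let $f:\mathbb{R}^{d_1}\times\mathbb{R}^{d_2}\to\mathbb{R}^{d_1}$ and $g:\mathbb{R}^{d_1}\times\mathbb{R}^{d_2}\to\mathbb{R}^{d_2}$. Standing assumptions: (i) There is a unique $(x^*,y^* )$ with $f(x^*,y^* )=0$ and $g(x^*,y^* )=0$. (ii) There is a map $\lambda:\mathbb{R}^{d_2}\to\mathbb{R}^{d_1}$ such that, for each $y$, $x=\lambda(y)$ is the unique solution of $f(x,y)=0$, and $\|\lambda(y_1)-\lambda(y_2)\|\le L_\lambda\|y_1-y_2\|$ for all $y_1,y_2$. (iii) $\|f(x_1,y_1)-f(x_2,y_2)\|\le L_f(\|x_1-x_2\|+\|y_1-y_2\|)$ for all arguments, and for some $\mu_f>0$, $\langle x_1-x_2,f(x_1,y)-f(x_2,y)\rangle\ge\mu_f\|x_1-x_2\|^2$ for all $x_1,x_2,y$. (iv) $\|g(x_1,y_1)-g(x_2,y_2)\|\le L_g(\|x_1-x_2\|+\|y_1-y_2\|)$ for all arguments, and for some $\mu_g>0$,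 $\langle y-y^*,g(\lambda(y),y)\rangle\ge\mu_g\|y-y^*\|^2$ for all $y$. The process starts from deterministic $x_0,y_0$ and is $$x_{k+1}=x_k-\alpha_k[f(x_k,y_k)+\xi_k],\qquad y_{k+1}=y_k-\beta_k[g(x_k,y_k)+\psi_k],\qquad k\ge0,$$ with positive step sizes $\alpha_k,\beta_k$ and random noises $\xi_k\in\mathbb{R}^{d_1}$, $\psi_k\in\mathbb{R}^{d_2}$. Let $\hat x_k=x_k-\lambda(y_k)$, $\hat y_k=y_k-y^*$, and let $\mathcal{Q}_k$ be the $\sigma$-algebra generated by $x_0,y_0,\xi_0,\psi_0,\dots,\xi_k,\psi_k$ ($\mathcal{Q}_{-1}$ is generated by $x_0,y_0$). (v) Noise (time-dependent): $\mathbb{E}[\xi_k\mid\mathcal{Q}_{k-1}]=0$, $\mathbb{E}[\psi_k\mid\mathcal{Q}_{k-1}]=0$, and, for the offset $k_0$ used in the step sizes, there are constants $\Gamma_{11}',\Gamma_{22}',\gamma_1,\gamma_2\ge0$ with $\gamma_1-\gamma_2\in[-1,\tfrac12)$ such that almost surely for all $k\ge0$ $$\mathbb{E}[\|\xi_k\|^2\mid\mathcal{Q}_{k-1}]\le\Gamma_{11}'(k+1+k_0)^{-\gamma_1},\qquad \mathbb{E}[\|\psi_k\|^2\mid\mathcal{Q}_{k-1}]\le\Gamma_{22}'(k+1+k_0)^{-\gamma_2}.$$ No assumption is made on the correlation between $\xi_k$ and $\psi_k$. Let $c=\dfrac{4L_g^2}{\mu_f\mu_g}$ and define the Lyapunov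 function $V_k=c\,\dfrac{\beta_k}{\alpha_k}\|\hat x_k\|^2+\|\hat y_k\|^2$. *)

theory Defs
  imports "HOL-Analysis.Analysis" "HOL-Probability.Probability"
begin

text \<open>The library has conditional expectation for scalar random variables only; for random
  vectors it is taken coordinatewise.\<close>

definition vec_cond_exp ::
  "'w measure \<Rightarrow> 'w measure \<Rightarrow> ('w \<Rightarrow> real ^ 'n) \<Rightarrow> 'w \<Rightarrow> real ^ 'n" where
  "vec_cond_exp P F X = (\<lambda>\<omega>. \<chi> i. real_cond_exp P F (\<lambda>\<omega>'. X \<omega>' $ i) \<omega>)"

text \<open>\<open>noise_history P X0 Y0 \<xi> \<psi> k\<close> is the \<open>\<sigma>\<close>-algebra generated by the initial values and by the
  noises with index strictly below \<open>k\<close>, i.e. \<open>\<Q>\<^bsub>k-1\<^esub>\<close>; the shift makes \<open>\<Q>\<^bsub>-1\<^esub>\<close> the case \<open>k = 0\<close>.\<close>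

definition noise_history ::
  "'w measure \<Rightarrow> ('w \<Rightarrow> real ^ 'm) \<Rightarrow> ('w \<Rightarrow> real ^ 'n) \<Rightarrow>
   (nat \<Rightarrow> 'w \<Rightarrow> real ^ 'm) \<Rightarrow> (nat \<Rightarrow> 'w \<Rightarrow> real ^ 'n) \<Rightarrow> nat \<Rightarrow> 'w measure" where
  "noise_history P X0 Y0 \<xi> \<psi> k = sigma (space P)
     ({X0 -` A \<inter> space P | A. A \<in> sets borel} \<union>
      {Y0 -` A \<inter> space P | A. A \<in> sets borel} \<union>
      {\<xi> j -` A \<inter> space P | j A. j < k \<and> A \<in> sets borel} \<union>
      {\<psi> j -` A \<inter> space P | j A. j < k \<and> A \<in> sets borel})"

end

theory Submission
  imports Defs
begin

text \<open>The proof is a Lyapunov argument in which the weight \<open>w\<^sub>k = c \<beta>\<^sub>k / \<alpha>\<^sub>k\<close> of the fast error balances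
  the coupling between the two time scales.

  Expanding one step of the recursion for every realisation of the noises gives
  \<open>V\<^sub>k\<^sub>+\<^sub>1 \<le> (1 - \<beta>\<^sub>k \<mu>g / 2 + C \<alpha>\<^sub>k\<^sup>2) V\<^sub>k\<close> plus multiples of the squared noises plus inner products of the
  noises with vectors determined by the past (lemma \<open>lyapunov_step\<close>). The contraction comes from the two
  monotonicity assumptions. The fast error contracts at rate \<open>\<alpha>\<^sub>k \<mu>f\<close>, which is large compared with
  \<open>\<beta>\<^sub>k\<close>; this surplus pays for the coupling of the slow error with the fast one and for the motion of
  the target \<open>\<lambda>(Y\<^sub>k)\<close> (lemma \<open>lyapunov_drift_bound\<close>). The latter also carries noise. Its product with
  the fast error is split by Young's inequality, which creates the term of order \<open>\<beta>\<^sub>k\<^sup>3 / \<alpha>\<^sub>k\<^sup>2\<close> in the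
  variance of \<open>\<psi>\<^sub>k\<close> (lemma \<open>fast_error_step\<close>).

  In the mean the linear noise terms vanish, as a centred noise is orthogonal to the past, and the
  squared noises are bounded by their conditional variances. Writing \<open>m = k + 1 + k\<^sub>0\<close>, the variance
  terms have orders \<open>\<alpha>\<^sub>k \<beta>\<^sub>k m powr (- \<gamma>1)\<close> and \<open>\<beta>\<^sub>k\<^sup>3 / \<alpha>\<^sub>k\<^sup>2 m powr (- \<gamma>2)\<close>. The exponent \<open>a\<close> is the one for
  which both decay like \<open>m powr (- (t + 1))\<close>. By the lower bounds on \<open>\<beta>\<close> and \<open>k\<^sub>0\<close> the mean of \<open>V\<close>
  therefore satisfies \<open>v\<^sub>k\<^sub>+\<^sub>1 \<le> (1 - (2 a + t - 1/6) / m) v\<^sub>k + C2 / m powr (t + 1)\<close>. The contraction is faster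
  than the decay of \<open>1 / m powr t\<close>, with enough room left for the noise term, so that the claimed bound is
  reproduced at each step (lemma \<open>recursion_step\<close>).\<close>

section \<open>One step of the error recursions\<close>

lemma weighted_young:
  fixes u v e :: real
  assumes "0 < e"
  shows "2 * u * v \<le> e * u\<^sup>2 + v\<^sup>2 / e"
proof -
  have "0 \<le> (e * u - v)\<^sup>2 / e" using assms by simp
  also have "\<dots> = e * u\<^sup>2 + v\<^sup>2 / e - 2 * u * v"
    using assms by (simp add: field_simps power2_eq_square)
  finally show ?thesis by simp
qed

text \<open>The fast error \<open>x = X\<^sub>k - \<lambda>(Y\<^sub>k)\<close> is moved by the step \<open>a (F + n)\<close> and by the displacement
  \<open>d\<close> of the target \<open>\<lambda>(Y\<^sub>k)\<close>, of which only the size is known. Because \<open>d\<close> depends on the noise \<open>p\<close>,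
  the term \<open>x \<bullet> d\<close> does not vanish in the mean. Half of the gain \<open>2 a \<mu> (norm x)\<^sup>2\<close> from monotonicity
  pays for its noisy part by Young's inequality; the price is a term in
  \<open>q\<^sup>2 / a\<close> times \<open>(norm p)\<^sup>2\<close>. The square of \<open>d - a n\<close> is bounded by twice the sum of the squares, so that
  the correlation of the two noises never enters. The last two terms are linear in the noise, with
  coefficients known before the step.\<close>

lemma fast_error_step:
  fixes x F n d :: "'a::real_inner" and G p :: "'b::real_inner"
  assumes a: "0 < a" and \<mu>: "0 < \<mu>" and L: "0 \<le> L" and q: "0 \<le> q"
    and F: "norm F \<le> L * norm x" and mono: "\<mu> * (norm x)\<^sup>2 \<le> x \<bullet> F"
    and d: "norm d \<le> q * norm (G + p)"
  shows "(norm (x - a *\<^sub>R (F + n) + d))\<^sup>2 \<le>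
    (1 - a * \<mu> + a\<^sup>2 * L\<^sup>2) * (norm x)\<^sup>2 + 2 * (1 + a * L) * q * norm x * norm G
    + 2 * q\<^sup>2 * (norm G)\<^sup>2 + 2 * a\<^sup>2 * (norm n)\<^sup>2
    + (2 / \<mu> * q\<^sup>2 * (1 / a + a * L\<^sup>2) + 2 * q\<^sup>2) * (norm p)\<^sup>2
    - 2 * a * ((x - a *\<^sub>R F) \<bullet> n) + 4 * q\<^sup>2 * (G \<bullet> p)"
proof -
  define z where "z = x - a *\<^sub>R F"
  have expand: "(norm (x - a *\<^sub>R (F + n) + d))\<^sup>2 =
      (norm z)\<^sup>2 + (norm (d - a *\<^sub>R n))\<^sup>2 - 2 * a * (z \<bullet> n) + 2 * (z \<bullet> d)"
    unfolding z_def power2_norm_eq_inner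
    by (simp add: inner_simps inner_commute algebra_simps)
  have F2: "(norm F)\<^sup>2 \<le> L\<^sup>2 * (norm x)\<^sup>2"
    using power_mono[OF F norm_ge_zero, of 2] by (simp add: power_mult_distrib)
  have "(norm z)\<^sup>2 = (norm x)\<^sup>2 - 2 * a * (x \<bullet> F) + a\<^sup>2 * (norm F)\<^sup>2"
    unfolding z_def power2_norm_eq_inner
    by (simp add: inner_simps inner_commute algebra_simps power2_eq_square)
  also have "\<dots> \<le> (norm x)\<^sup>2 - 2 * a * (\<mu> * (norm x)\<^sup>2) + a\<^sup>2 * (L\<^sup>2 * (norm x)\<^sup>2)"
    using mono F2 a by (intro add_mono diff_mono mult_left_mono) auto
  finally have z2: "(norm z)\<^sup>2 \<le> (1 - 2 * a * \<mu> + a\<^sup>2 * L\<^sup>2) * (norm x)\<^sup>2"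
    by (simp add: algebra_simps)
  have "norm z \<le> norm x + a * norm F"
    unfolding z_def using norm_triangle_ineq4[of x "a *\<^sub>R F"] a by simp
  also have "\<dots> \<le> norm x + a * (L * norm x)"
    using F a by simp
  finally have z1: "norm z \<le> (1 + a * L) * norm x" by (simp add: algebra_simps)
  have Gp: "(norm (G + p))\<^sup>2 = (norm G)\<^sup>2 + 2 * (G \<bullet> p) + (norm p)\<^sup>2"
    unfolding power2_norm_eq_inner by (simp add: inner_simps inner_commute)
  have d2: "(norm d)\<^sup>2 \<le> q\<^sup>2 * ((norm G)\<^sup>2 + 2 * (G \<bullet> p) + (norm p)\<^sup>2)"
    using power_mono[OF d norm_ge_zero, of 2] by (simp add: power_mult_distrib Gp)
  have "0 \<le> (norm (d + a *\<^sub>R n))\<^sup>2" by simp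
  also have "\<dots> = 2 * (norm d)\<^sup>2 + 2 * a\<^sup>2 * (norm n)\<^sup>2 - (norm (d - a *\<^sub>R n))\<^sup>2"
    unfolding power2_norm_eq_inner
    by (simp add: inner_simps inner_commute algebra_simps power2_eq_square)
  finally have dn: "(norm (d - a *\<^sub>R n))\<^sup>2 \<le> 2 * (norm d)\<^sup>2 + 2 * a\<^sup>2 * (norm n)\<^sup>2" by simp
  have "z \<bullet> d \<le> norm z * norm d" by (rule norm_cauchy_schwarz)
  also have "\<dots> \<le> ((1 + a * L) * norm x) * (q * (norm G + norm p))"
    using z1 d q mult_left_mono[OF norm_triangle_ineq[of G p] q] a L
    by (intro mult_mono) auto
  finally have zd: "2 * (z \<bullet> d) \<le> 2 * (1 + a * L) * q * norm x * norm G
      + (2 * norm x * (q * norm p) + a * (2 * norm x * (L * q * norm p)))"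
    by (simp add: algebra_simps)
  have y1: "2 * norm x * (q * norm p) \<le> a * \<mu> / 2 * (norm x)\<^sup>2 + (q * norm p)\<^sup>2 / (a * \<mu> / 2)"
    using a \<mu> by (intro weighted_young) simp
  have "2 * norm x * (L * q * norm p) \<le> \<mu> / 2 * (norm x)\<^sup>2 + (L * q * norm p)\<^sup>2 / (\<mu> / 2)"
    using \<mu> by (intro weighted_young) simp
  then have y2: "a * (2 * norm x * (L * q * norm p))
      \<le> a * (\<mu> / 2 * (norm x)\<^sup>2 + (L * q * norm p)\<^sup>2 / (\<mu> / 2))"
    using a by simp
  have eq: "(q * norm p)\<^sup>2 / (a * \<mu> / 2) + a * ((L * q * norm p)\<^sup>2 / (\<mu> / 2))
      = 2 / \<mu> * q\<^sup>2 * (1 / a + a * L\<^sup>2) * (norm p)\<^sup>2"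
    using a \<mu> by (simp add: field_simps power2_eq_square)
  show ?thesis
    using expand z2 dn d2 zd y1 y2 eq
    unfolding z_def[symmetric] by (simp add: algebra_simps)
qed

lemma slow_error_step:
  fixes y G h p :: "'b::real_inner"
  assumes b: "0 < b"
    and mono: "\<mu> * (norm y)\<^sup>2 \<le> y \<bullet> h" and h: "norm (G - h) \<le> r"
  shows "(norm (y - b *\<^sub>R (G + p)))\<^sup>2 \<le>
    (1 - 2 * b * \<mu>) * (norm y)\<^sup>2 + 2 * b * r * norm y + b\<^sup>2 * (norm G)\<^sup>2
    + b\<^sup>2 * (norm p)\<^sup>2 - 2 * b * ((y - b *\<^sub>R G) \<bullet> p)"
proof -
  have expand: "(norm (y - b *\<^sub>R (G + p)))\<^sup>2 = (norm y)\<^sup>2 - 2 * b * (y \<bullet> h) - 2 * b * (y \<bullet> (G - h))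
      + b\<^sup>2 * (norm G)\<^sup>2 + b\<^sup>2 * (norm p)\<^sup>2 - 2 * b * ((y - b *\<^sub>R G) \<bullet> p)"
    unfolding power2_norm_eq_inner
    by (simp add: inner_simps inner_commute algebra_simps power2_eq_square)
  have "\<bar>y \<bullet> (G - h)\<bar> \<le> norm y * norm (G - h)" by (rule Cauchy_Schwarz_ineq2)
  also have "\<dots> \<le> norm y * r" using h by (intro mult_left_mono) auto
  finally have "- (norm y * r) \<le> y \<bullet> (G - h)" by linarith
  then have "2 * b * (- (norm y * r)) \<le> 2 * b * (y \<bullet> (G - h))"
    using b by (intro mult_left_mono) auto
  moreover have "2 * b * (\<mu> * (norm y)\<^sup>2) \<le> 2 * b * (y \<bullet> h)"
    using mono b by (intro mult_left_mono) auto
  ultimately show ?thesis unfolding expand by (simp add: algebra_simps)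
qed

section \<open>Drift of the Lyapunov function\<close>

text \<open>The coefficient of \<open>a\<^sup>2\<close> in the drift of the Lyapunov function: each summand absorbs one of the
  second-order error terms. The first comes from the square of \<open>f\<close>, the third and fourth from the
  product of \<open>f\<close> with the motion of the target, the second and sixth from the square of that motion,
  and the fifth and seventh from the square of \<open>g\<close> in the slow recursion.\<close>

definition drift_const :: "real \<Rightarrow> real \<Rightarrow> real \<Rightarrow> real \<Rightarrow> real \<Rightarrow> real \<Rightarrow> real \<Rightarrow> real" where
  "drift_const Lf Lg L \<mu>g c r \<beta> = Lf\<^sup>2 + 4 * L\<^sup>2 * Lg\<^sup>2 * r\<^sup>2 + 2 * Lf * L * Lg * r
      + 2 / \<mu>g * Lf\<^sup>2 * L\<^sup>2 * Lg\<^sup>2 * (L + 1)\<^sup>2 * \<beta> + 1 / c * Lg\<^sup>2 * (L + 2) * r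
      + 4 * c * L\<^sup>2 * Lg\<^sup>2 * (L + 1)\<^sup>2 * r ^ 3 + Lg\<^sup>2 * (2 * L\<^sup>2 + L + 3) * r\<^sup>2"

text \<open>With \<open>X\<close>, \<open>Y\<close>, \<open>N\<close> the norms of the fast error, of the slow error and of \<open>g\<close>, the noiseless parts
  of the two error recursions add up to a contraction. The budget is as follows. The fast error has
  the gain \<open>w a \<mu>f X\<^sup>2\<close>. One quarter of it pays for the motion of the target at first order
  (hypothesis \<open>rat\<close>), and one quarter pays for the coupling \<open>2 b Lg X Y\<close> of the slow error; the constant
  \<open>c\<close> is chosen to make the latter exact. The remaining half is at least \<open>w b \<mu>g X\<^sup>2 / 2\<close> by \<open>rat2\<close>.
  The slow error has the gain \<open>2 b \<mu>g Y\<^sup>2\<close>, of which the coupling takes \<open>b \<mu>g Y\<^sup>2\<close> and the two mixed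
  terms of the fast recursion take \<open>b \<mu>g Y\<^sup>2 / 4\<close> each, thanks to \<open>w \<le> 1 / 2\<close>. All that is left is of
  order \<open>a\<^sup>2\<close>.\<close>

lemma lyapunov_drift_bound:
  fixes X Y N :: real
  assumes nn: "0 \<le> X" "0 \<le> Y" "0 \<le> N" and L: "0 \<le> Lf" "0 \<le> Lg" "0 \<le> L"
    and pos: "0 < \<mu>f" "0 < \<mu>g" "0 < c" "0 < a" "0 < b"
    and N: "N \<le> Lg * X + Lg * (L + 1) * Y"
    and c: "c = 4 * Lg\<^sup>2 / (\<mu>f * \<mu>g)"
    and w: "w = c * (b / a)" "w \<le> 1 / 2"
    and br: "b \<le> r * a" and bB: "b \<le> \<beta>"
    and rat: "b * (2 * L * Lg + 2 / \<mu>g * L\<^sup>2 * Lg\<^sup>2 * (L + 1)\<^sup>2) \<le> a * \<mu>f / 4"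
    and rat2: "b * \<mu>g \<le> a * \<mu>f"
  shows "w * ((1 - a * \<mu>f + a\<^sup>2 * Lf\<^sup>2) * X\<^sup>2 + 2 * (1 + a * Lf) * (L * b) * X * N
      + 2 * (L * b)\<^sup>2 * N\<^sup>2)
    + ((1 - 2 * b * \<mu>g) * Y\<^sup>2 + 2 * b * (Lg * X) * Y + b\<^sup>2 * N\<^sup>2)
    \<le> (1 - b * \<mu>g / 2 + drift_const Lf Lg L \<mu>g c r \<beta> * a\<^sup>2) * (w * X\<^sup>2 + Y\<^sup>2)"
proof -
  define K where "K = Lg * (L + 1)"
  have K: "0 \<le> K" using L by (simp add: K_def)
  have w0: "0 < w" using w(1) pos by simp
  have wa: "w * a = c * b" using w(1) pos by simp
  \<comment> \<open>The square of \<open>N\<close> occurs in both recursions and is split differently in each: a rough split in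
    the fast one, a sharper one in the slow one.\<close>
  have N2a: "N\<^sup>2 \<le> 2 * Lg\<^sup>2 * X\<^sup>2 + 2 * K\<^sup>2 * Y\<^sup>2"
  proof -
    have "N\<^sup>2 \<le> (Lg * X + K * Y)\<^sup>2" using N nn unfolding K_def by (intro power_mono) auto
    also have "\<dots> \<le> 2 * Lg\<^sup>2 * X\<^sup>2 + 2 * K\<^sup>2 * Y\<^sup>2"
      using sum_squares_bound[of "Lg * X" "K * Y"]
      by (simp add: power2_sum power_mult_distrib algebra_simps)
    finally show ?thesis .
  qed
  have N2b: "N\<^sup>2 \<le> Lg\<^sup>2 * (L + 2) * X\<^sup>2 + Lg\<^sup>2 * (2 * L\<^sup>2 + L + 3) * Y\<^sup>2"
  proof -
    have "N\<^sup>2 \<le> (Lg * X + Lg * (L + 1) * Y)\<^sup>2" using N nn by (intro power_mono) auto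
    also have "\<dots> = Lg\<^sup>2 * (X\<^sup>2 + (L + 1) * (2 * X * Y) + (L + 1)\<^sup>2 * Y\<^sup>2)"
      by (simp add: power2_eq_square algebra_simps)
    also have "\<dots> \<le> Lg\<^sup>2 * (X\<^sup>2 + (L + 1) * (X\<^sup>2 + Y\<^sup>2) + (L + 1)\<^sup>2 * Y\<^sup>2)"
      using sum_squares_bound[of X Y] L by (intro mult_left_mono add_mono) auto
    \<comment> \<open>The coefficient \<open>(L + 1) * (L + 2)\<close> of \<open>Y\<^sup>2\<close> falls short of \<open>2 * L\<^sup>2 + L + 3\<close> by a square.\<close>
    also have "\<dots> = Lg\<^sup>2 * (L + 2) * X\<^sup>2 + Lg\<^sup>2 * (2 * L\<^sup>2 + L + 3) * Y\<^sup>2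
        - Lg\<^sup>2 * ((L - 1)\<^sup>2 * Y\<^sup>2)"
      by (simp add: power2_eq_square algebra_simps)
    also have "\<dots> \<le> Lg\<^sup>2 * (L + 2) * X\<^sup>2 + Lg\<^sup>2 * (2 * L\<^sup>2 + L + 3) * Y\<^sup>2"
      by simp
    finally show ?thesis .
  qed
  have wXN: "w * (2 * (1 + a * Lf) * (L * b) * X * N)
     \<le> w * (2 * (1 + a * Lf) * (L * b) * X * (Lg * X + K * Y))"
    using N nn L w0 pos unfolding K_def by (intro mult_left_mono) auto
  have y1: "2 * (L * K * X) * Y \<le> 2 / \<mu>g * (L * K * X)\<^sup>2 + Y\<^sup>2 / (2 / \<mu>g)"
    using pos by (intro weighted_young) simp
  have y2: "2 * (a * Lf * L * K * X) * Y \<le> 2 / \<mu>g * (a * Lf * L * K * X)\<^sup>2 + Y\<^sup>2 / (2 / \<mu>g)"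
    using pos by (intro weighted_young) simp
  have y3: "2 * Y * (Lg * X) \<le> \<mu>g * Y\<^sup>2 + (Lg * X)\<^sup>2 / \<mu>g"
    using pos by (intro weighted_young) simp
  have m1: "w * b * (2 * (L * K * X) * Y) \<le> w * b * (2 / \<mu>g * (L * K * X)\<^sup>2) + b * \<mu>g / 4 * Y\<^sup>2"
  proof -
    have "w * b * (2 * (L * K * X) * Y) \<le> w * b * (2 / \<mu>g * (L * K * X)\<^sup>2 + Y\<^sup>2 / (2 / \<mu>g))"
      using y1 w0 pos by (intro mult_left_mono) auto
    moreover have "w * (b * \<mu>g / 2 * Y\<^sup>2) \<le> 1 / 2 * (b * \<mu>g / 2 * Y\<^sup>2)"
      using w(2) pos by (intro mult_right_mono) auto
    ultimately show ?thesis by (simp add: algebra_simps)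
  qed
  have m2: "w * b * (2 * (a * Lf * L * K * X) * Y)
      \<le> w * (b * (2 / \<mu>g * (a * Lf * L * K * X)\<^sup>2)) + b * \<mu>g / 4 * Y\<^sup>2"
  proof -
    have "w * b * (2 * (a * Lf * L * K * X) * Y)
       \<le> w * b * (2 / \<mu>g * (a * Lf * L * K * X)\<^sup>2 + Y\<^sup>2 / (2 / \<mu>g))"
      using y2 w0 pos by (intro mult_left_mono) auto
    moreover have "w * (b * \<mu>g / 2 * Y\<^sup>2) \<le> 1 / 2 * (b * \<mu>g / 2 * Y\<^sup>2)"
      using w(2) pos by (intro mult_right_mono) auto
    ultimately show ?thesis by (simp add: algebra_simps)
  qed
  have m3: "2 * b * (Lg * X) * Y \<le> b * \<mu>g * Y\<^sup>2 + w * (a * \<mu>f / 4) * X\<^sup>2"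
  proof -
    have "b * (2 * Y * (Lg * X)) \<le> b * (\<mu>g * Y\<^sup>2 + (Lg * X)\<^sup>2 / \<mu>g)"
      using y3 pos by (intro mult_left_mono) auto
    moreover have "w * (a * \<mu>f / 4) * X\<^sup>2 = b * ((Lg * X)\<^sup>2 / \<mu>g)"
    proof -
      have "w * (a * \<mu>f / 4) * X\<^sup>2 = b * (c * \<mu>f / 4) * X\<^sup>2" using wa by (simp add: algebra_simps)
      also have "c * \<mu>f / 4 = Lg\<^sup>2 / \<mu>g" using pos by (simp add: c)
      finally show ?thesis by (simp add: power_mult_distrib)
    qed
    ultimately show ?thesis by (simp add: algebra_simps)
  qed
  have m4: "w * (b * (2 * L * Lg) * X\<^sup>2 + b * (2 / \<mu>g * (L * K * X)\<^sup>2)) \<le> w * (a * \<mu>f / 4) * X\<^sup>2"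
  proof -
    have "w * (b * (2 * L * Lg) * X\<^sup>2 + b * (2 / \<mu>g * (L * K * X)\<^sup>2)) =
       w * (b * (2 * L * Lg + 2 / \<mu>g * L\<^sup>2 * Lg\<^sup>2 * (L + 1)\<^sup>2)) * X\<^sup>2"
      unfolding K_def power_mult_distrib by (simp add: algebra_simps)
    also have "\<dots> \<le> w * (a * \<mu>f / 4) * X\<^sup>2"
      using rat w0 by (intro mult_right_mono mult_left_mono) auto
    finally show ?thesis .
  qed
  have b2: "b\<^sup>2 \<le> r\<^sup>2 * a\<^sup>2"
    using power_mono[OF br, of 2] pos by (simp add: power_mult_distrib)
  have r0: "0 < r" using br pos by (smt (verit) zero_less_mult_iff)
  define t1 t2 t3 t4 t5 t6 t7 where T: "t1 = Lf\<^sup>2" "t2 = 4 * L\<^sup>2 * Lg\<^sup>2 * r\<^sup>2" "t3 = 2 * Lf * L * Lg * r"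
    "t4 = 2 / \<mu>g * Lf\<^sup>2 * L\<^sup>2 * Lg\<^sup>2 * (L + 1)\<^sup>2 * \<beta>" "t5 = 1 / c * Lg\<^sup>2 * (L + 2) * r"
    "t6 = 4 * c * L\<^sup>2 * Lg\<^sup>2 * (L + 1)\<^sup>2 * r ^ 3" "t7 = Lg\<^sup>2 * (2 * L\<^sup>2 + L + 3) * r\<^sup>2"
  have T0: "0 \<le> t1" "0 \<le> t2" "0 \<le> t3" "0 \<le> t4" "0 \<le> t5" "0 \<le> t6" "0 \<le> t7"
    unfolding T using L pos r0 bB by auto
  have q2: "w * (2 * (L * b)\<^sup>2 * (2 * Lg\<^sup>2 * X\<^sup>2)) \<le> t2 * a\<^sup>2 * (w * X\<^sup>2)"
  proof -
    have "w * (2 * (L * b)\<^sup>2 * (2 * Lg\<^sup>2 * X\<^sup>2)) = (4 * L\<^sup>2 * Lg\<^sup>2 * (w * X\<^sup>2)) * b\<^sup>2"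
      by (simp add: power_mult_distrib algebra_simps)
    also have "\<dots> \<le> (4 * L\<^sup>2 * Lg\<^sup>2 * (w * X\<^sup>2)) * (r\<^sup>2 * a\<^sup>2)"
      using b2 w0 by (intro mult_left_mono) auto
    finally show ?thesis unfolding T by (simp add: algebra_simps)
  qed
  have q3: "w * (2 * (a * Lf) * (L * b) * X * (Lg * X)) \<le> t3 * a\<^sup>2 * (w * X\<^sup>2)"
  proof -
    have "w * (2 * (a * Lf) * (L * b) * X * (Lg * X)) = (2 * a * Lf * L * Lg * (w * X\<^sup>2)) * b"
      by (simp add: power2_eq_square algebra_simps)
    also have "\<dots> \<le> (2 * a * Lf * L * Lg * (w * X\<^sup>2)) * (r * a)"
      using br w0 L pos by (intro mult_left_mono) auto
    finally show ?thesis unfolding T by (simp add: power2_eq_square algebra_simps)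
  qed
  have q4: "w * (b * (2 / \<mu>g * (a * Lf * L * K * X)\<^sup>2)) \<le> t4 * a\<^sup>2 * (w * X\<^sup>2)"
  proof -
    have "w * (b * (2 / \<mu>g * (a * Lf * L * K * X)\<^sup>2)) =
        (2 / \<mu>g * Lf\<^sup>2 * L\<^sup>2 * Lg\<^sup>2 * (L + 1)\<^sup>2 * a\<^sup>2 * (w * X\<^sup>2)) * b"
      unfolding K_def power_mult_distrib by (simp add: algebra_simps)
    also have "\<dots> \<le> (2 / \<mu>g * Lf\<^sup>2 * L\<^sup>2 * Lg\<^sup>2 * (L + 1)\<^sup>2 * a\<^sup>2 * (w * X\<^sup>2)) * \<beta>"
      using bB w0 L pos by (intro mult_left_mono) auto
    finally show ?thesis unfolding T by (simp add: algebra_simps)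
  qed
  have q5: "b\<^sup>2 * (Lg\<^sup>2 * (L + 2) * X\<^sup>2) \<le> t5 * a\<^sup>2 * (w * X\<^sup>2)"
  proof -
    have "b\<^sup>2 * (Lg\<^sup>2 * (L + 2) * X\<^sup>2) = (1 / c * Lg\<^sup>2 * (L + 2) * X\<^sup>2 * b) * (w * a)"
      using pos unfolding wa by (simp add: field_simps power2_eq_square)
    also have "\<dots> \<le> (1 / c * Lg\<^sup>2 * (L + 2) * X\<^sup>2 * (r * a)) * (w * a)"
      using br w0 L pos by (intro mult_right_mono mult_left_mono) auto
    finally show ?thesis unfolding T by (simp add: power2_eq_square algebra_simps)
  qed
  have q6: "w * (2 * (L * b)\<^sup>2 * (2 * K\<^sup>2 * Y\<^sup>2)) \<le> t6 * a\<^sup>2 * Y\<^sup>2"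
  proof -
    have "b / a \<le> r" using br pos by (simp add: field_simps)
    then have "w \<le> c * r" using pos unfolding w(1) by (intro mult_left_mono) auto
    then have "w * b\<^sup>2 \<le> (c * r) * (r\<^sup>2 * a\<^sup>2)"
      using b2 w0 by (intro mult_mono) auto
    then have "4 * L\<^sup>2 * K\<^sup>2 * Y\<^sup>2 * (w * b\<^sup>2) \<le> 4 * L\<^sup>2 * K\<^sup>2 * Y\<^sup>2 * ((c * r) * (r\<^sup>2 * a\<^sup>2))"
      by (intro mult_left_mono) auto
    then show ?thesis unfolding T K_def
      by (simp add: power_mult_distrib power2_eq_square power3_eq_cube mult_ac)
  qed
  have q7: "b\<^sup>2 * (Lg\<^sup>2 * (2 * L\<^sup>2 + L + 3) * Y\<^sup>2) \<le> t7 * a\<^sup>2 * Y\<^sup>2"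
  proof -
    have "(Lg\<^sup>2 * (2 * L\<^sup>2 + L + 3) * Y\<^sup>2) * b\<^sup>2 \<le> (Lg\<^sup>2 * (2 * L\<^sup>2 + L + 3) * Y\<^sup>2) * (r\<^sup>2 * a\<^sup>2)"
      using b2 L by (intro mult_left_mono) auto
    then show ?thesis unfolding T by (simp add: mult_ac)
  qed
  have n1: "w * (2 * (L * b)\<^sup>2 * N\<^sup>2)
      \<le> w * (2 * (L * b)\<^sup>2 * (2 * Lg\<^sup>2 * X\<^sup>2)) + w * (2 * (L * b)\<^sup>2 * (2 * K\<^sup>2 * Y\<^sup>2))"
  proof -
    have "w * (2 * (L * b)\<^sup>2 * N\<^sup>2) \<le> w * (2 * (L * b)\<^sup>2 * (2 * Lg\<^sup>2 * X\<^sup>2 + 2 * K\<^sup>2 * Y\<^sup>2))"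
      using N2a w0 by (intro mult_left_mono) auto
    then show ?thesis by (simp only: distrib_left)
  qed
  have n2: "b\<^sup>2 * N\<^sup>2 \<le> b\<^sup>2 * (Lg\<^sup>2 * (L + 2) * X\<^sup>2) + b\<^sup>2 * (Lg\<^sup>2 * (2 * L\<^sup>2 + L + 3) * Y\<^sup>2)"
    using mult_left_mono[OF N2b, of "b\<^sup>2"] by (simp only: distrib_left) simp
  have e1: "w * (2 * (1 + a * Lf) * (L * b) * X * (Lg * X + K * Y)) =
     w * (b * (2 * L * Lg) * X\<^sup>2) + w * b * (2 * (L * K * X) * Y)
     + w * (2 * (a * Lf) * (L * b) * X * (Lg * X)) + w * b * (2 * (a * Lf * L * K * X) * Y)"
    by (simp add: power2_eq_square algebra_simps)
  have m4': "w * (b * (2 * L * Lg) * X\<^sup>2) + w * b * (2 / \<mu>g * (L * K * X)\<^sup>2) \<le> w * (a * \<mu>f / 4) * X\<^sup>2"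
    using m4 by (simp only: distrib_left mult.assoc)
  have dX: "w * (b * \<mu>g / 2) * X\<^sup>2 \<le> w * (a * \<mu>f / 2) * X\<^sup>2"
    using rat2 w0 by (intro mult_right_mono mult_left_mono) auto
  define Q where "Q = a\<^sup>2 * (w * X\<^sup>2)"
  define R where "R = a\<^sup>2 * Y\<^sup>2"
  have QR: "0 \<le> Q" "0 \<le> R" unfolding Q_def R_def using w0 by auto
  have s: "(t1 + t2 + t3 + t4 + t5) * Q + (t6 + t7) * R \<le> (t1 + t2 + t3 + t4 + t5 + t6 + t7) * (Q + R)"
  proof -
    have "0 \<le> (t6 + t7) * Q + (t1 + t2 + t3 + t4 + t5) * R" using QR T0 by auto
    then show ?thesis by (simp add: algebra_simps)
  qed
  have C: "drift_const Lf Lg L \<mu>g c r \<beta> = t1 + t2 + t3 + t4 + t5 + t6 + t7"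
    unfolding drift_const_def T ..
  have lhs: "w * ((1 - a * \<mu>f + a\<^sup>2 * Lf\<^sup>2) * X\<^sup>2 + 2 * (1 + a * Lf) * (L * b) * X * N
      + 2 * (L * b)\<^sup>2 * N\<^sup>2)
    + ((1 - 2 * b * \<mu>g) * Y\<^sup>2 + 2 * b * (Lg * X) * Y + b\<^sup>2 * N\<^sup>2)
    = w * X\<^sup>2 - w * (a * \<mu>f) * X\<^sup>2 + t1 * Q + w * (2 * (1 + a * Lf) * (L * b) * X * N)
     + w * (2 * (L * b)\<^sup>2 * N\<^sup>2) + Y\<^sup>2 - 2 * (b * \<mu>g * Y\<^sup>2) + 2 * b * (Lg * X) * Y + b\<^sup>2 * N\<^sup>2"
    unfolding T Q_def by (simp add: algebra_simps)
  have rhs: "(1 - b * \<mu>g / 2 + drift_const Lf Lg L \<mu>g c r \<beta> * a\<^sup>2) * (w * X\<^sup>2 + Y\<^sup>2)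
    = w * X\<^sup>2 + Y\<^sup>2 - w * (b * \<mu>g / 2) * X\<^sup>2 - b * \<mu>g / 2 * Y\<^sup>2
      + (t1 + t2 + t3 + t4 + t5 + t6 + t7) * (Q + R)"
    unfolding C Q_def R_def by (simp add: algebra_simps)
  have q': "t2 * a\<^sup>2 * (w * X\<^sup>2) = t2 * Q" "t3 * a\<^sup>2 * (w * X\<^sup>2) = t3 * Q" "t4 * a\<^sup>2 * (w * X\<^sup>2) = t4 * Q"
    "t5 * a\<^sup>2 * (w * X\<^sup>2) = t5 * Q" "t6 * a\<^sup>2 * Y\<^sup>2 = t6 * R" "t7 * a\<^sup>2 * Y\<^sup>2 = t7 * R"
    unfolding Q_def R_def by simp_all
  have s': "t1 * Q + t2 * Q + t3 * Q + t4 * Q + t5 * Q + t6 * R + t7 * R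
      \<le> (t1 + t2 + t3 + t4 + t5 + t6 + t7) * (Q + R)"
    using s by (simp only: distrib_right)
  have h: "w * (a * \<mu>f / 4) * X\<^sup>2 = (w * (a * \<mu>f) * X\<^sup>2) / 4" "w * (a * \<mu>f / 2) * X\<^sup>2 = (w * (a * \<mu>f) * X\<^sup>2) / 2"
    "b * \<mu>g / 4 * Y\<^sup>2 = (b * \<mu>g * Y\<^sup>2) / 4" "b * \<mu>g / 2 * Y\<^sup>2 = (b * \<mu>g * Y\<^sup>2) / 2" by simp_all
  show ?thesis
    unfolding lhs rhs
    using wXN m1 m2 m3 m4' q2 q3 q4 q5 q6 q7 n1 n2 dX s' unfolding e1 q' h by linarith
qed


text \<open>The inequality holds for every realisation of the noises, so no conditional expectation is needed
  to obtain it. The noises enter through their squared norms, which have bounded means, and through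
  inner products with vectors determined by the past, which have mean zero. Allowing the new weight
  \<open>w'\<close> to be smaller than \<open>w\<close> accounts for the step-size ratio decreasing in time.\<close>

lemma lyapunov_step:
  fixes f :: "'a::real_inner \<Rightarrow> 'b::real_inner \<Rightarrow> 'a" and g :: "'a \<Rightarrow> 'b \<Rightarrow> 'b"
    and lam :: "'b \<Rightarrow> 'a" and x n :: 'a and y p ys :: 'b
  assumes f_root: "\<And>y. f (lam y) y = 0" and g_root: "g (lam ys) ys = 0"
    and lam_lip: "\<And>y1 y2. norm (lam y1 - lam y2) \<le> L * norm (y1 - y2)"
    and f_lip: "\<And>x1 x2 y1 y2. norm (f x1 y1 - f x2 y2) \<le> Lf * (norm (x1 - x2) + norm (y1 - y2))"
    and f_mono: "\<And>x1 x2 y. (x1 - x2) \<bullet> (f x1 y - f x2 y) \<ge> \<mu>f * (norm (x1 - x2))\<^sup>2"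
    and g_lip: "\<And>x1 x2 y1 y2. norm (g x1 y1 - g x2 y2) \<le> Lg * (norm (x1 - x2) + norm (y1 - y2))"
    and g_mono: "\<And>y. (y - ys) \<bullet> g (lam y) y \<ge> \<mu>g * (norm (y - ys))\<^sup>2"
    and L: "0 \<le> Lf" "0 \<le> Lg" "0 \<le> L"
    and pos: "0 < \<mu>f" "0 < \<mu>g" "0 < c" "0 < a" "0 < b"
    and c: "c = 4 * Lg\<^sup>2 / (\<mu>f * \<mu>g)"
    and w: "w = c * (b / a)" "w \<le> 1 / 2" and w': "w' \<le> w"
    and br: "b \<le> r * a" and bB: "b \<le> \<beta>"
    and rat: "b * (2 * L * Lg + 2 / \<mu>g * L\<^sup>2 * Lg\<^sup>2 * (L + 1)\<^sup>2) \<le> a * \<mu>f / 4"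
    and rat2: "b * \<mu>g \<le> a * \<mu>f"
    and x': "x' = x - a *\<^sub>R (f x y + n)" and y': "y' = y - b *\<^sub>R (g x y + p)"
  shows "w' * (norm (x' - lam y'))\<^sup>2 + (norm (y' - ys))\<^sup>2 \<le>
    (1 - b * \<mu>g / 2 + drift_const Lf Lg L \<mu>g c r \<beta> * a\<^sup>2)
      * (w * (norm (x - lam y))\<^sup>2 + (norm (y - ys))\<^sup>2)
    + 2 * w * a\<^sup>2 * (norm n)\<^sup>2
    + (w * (2 / \<mu>f * (L * b)\<^sup>2 * (1 / a + a * Lf\<^sup>2) + 2 * (L * b)\<^sup>2) + b\<^sup>2) * (norm p)\<^sup>2
    + ((- 2 * w * a) *\<^sub>R ((x - lam y) - a *\<^sub>R f x y)) \<bullet> n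
    + ((4 * w * (L * b)\<^sup>2) *\<^sub>R g x y - (2 * b) *\<^sub>R ((y - ys) - b *\<^sub>R g x y)) \<bullet> p"
proof -
  define xh where "xh = x - lam y"
  define yh where "yh = y - ys"
  have w0: "0 < w" using w(1) pos by simp
  have F: "norm (f x y) \<le> Lf * norm xh"
    using f_lip[of x y "lam y" y] f_root[of y] by (simp add: xh_def)
  have mono: "\<mu>f * (norm xh)\<^sup>2 \<le> xh \<bullet> f x y"
    using f_mono[of x "lam y" y] f_root[of y] by (simp add: xh_def)
  have "y - y' = b *\<^sub>R (g x y + p)" by (simp add: y')
  then have d: "norm (lam y - lam y') \<le> (L * b) * norm (g x y + p)"
    using lam_lip[of y y'] pos by simp
  have gh: "norm (g x y - g (lam y) y) \<le> Lg * norm xh"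
    using g_lip[of x y "lam y" y] by (simp add: xh_def)
  have "norm (g (lam y) y) \<le> Lg * (norm (lam y - lam ys) + norm yh)"
    using g_lip[of "lam y" y "lam ys" ys] g_root by (simp add: yh_def)
  also have "\<dots> \<le> Lg * (L * norm yh + norm yh)"
    using lam_lip[of y ys] L by (intro mult_left_mono add_mono) (auto simp: yh_def)
  finally have N: "norm (g x y) \<le> Lg * norm xh + Lg * (L + 1) * norm yh"
    using gh norm_triangle_ineq[of "g x y - g (lam y) y" "g (lam y) y"] by (simp add: algebra_simps)
  have fast_eq: "x' - lam y' = xh - a *\<^sub>R (f x y + n) + (lam y - lam y')"
    by (simp add: x' xh_def)
  have fast: "(norm (x' - lam y'))\<^sup>2 \<le>
      (1 - a * \<mu>f + a\<^sup>2 * Lf\<^sup>2) * (norm xh)\<^sup>2 + 2 * (1 + a * Lf) * (L * b) * norm xh * norm (g x y)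
      + 2 * (L * b)\<^sup>2 * (norm (g x y))\<^sup>2 + 2 * a\<^sup>2 * (norm n)\<^sup>2
      + (2 / \<mu>f * (L * b)\<^sup>2 * (1 / a + a * Lf\<^sup>2) + 2 * (L * b)\<^sup>2) * (norm p)\<^sup>2
      - 2 * a * ((xh - a *\<^sub>R f x y) \<bullet> n) + 4 * (L * b)\<^sup>2 * (g x y \<bullet> p)" (is "_ \<le> ?fast")
    unfolding fast_eq by (rule fast_error_step[OF pos(4,1) L(1) _ F mono d]) (use L pos in simp)
  have slow_eq: "y' - ys = yh - b *\<^sub>R (g x y + p)" by (simp add: y' yh_def)
  have slow: "(norm (y' - ys))\<^sup>2 \<le>
      (1 - 2 * b * \<mu>g) * (norm yh)\<^sup>2 + 2 * b * (Lg * norm xh) * norm yh + b\<^sup>2 * (norm (g x y))\<^sup>2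
      + b\<^sup>2 * (norm p)\<^sup>2 - 2 * b * ((yh - b *\<^sub>R g x y) \<bullet> p)"
    unfolding slow_eq by (rule slow_error_step[OF pos(5) _ gh]) (use g_mono[of y] in \<open>simp add: yh_def\<close>)
  have "w' * (norm (x' - lam y'))\<^sup>2 \<le> w * (norm (x' - lam y'))\<^sup>2"
    using w' by (intro mult_right_mono) auto
  also have "\<dots> \<le> w * ?fast" using fast w0 by (intro mult_left_mono) auto
  also have "\<dots> = w * ((1 - a * \<mu>f + a\<^sup>2 * Lf\<^sup>2) * (norm xh)\<^sup>2
        + 2 * (1 + a * Lf) * (L * b) * norm xh * norm (g x y) + 2 * (L * b)\<^sup>2 * (norm (g x y))\<^sup>2)
      + 2 * w * a\<^sup>2 * (norm n)\<^sup>2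
      + w * (2 / \<mu>f * (L * b)\<^sup>2 * (1 / a + a * Lf\<^sup>2) + 2 * (L * b)\<^sup>2) * (norm p)\<^sup>2
      + ((- 2 * w * a) *\<^sub>R (xh - a *\<^sub>R f x y)) \<bullet> n + ((4 * w * (L * b)\<^sup>2) *\<^sub>R g x y) \<bullet> p"
    by (simp add: distrib_left right_diff_distrib)
  finally have fast': "w' * (norm (x' - lam y'))\<^sup>2 \<le> \<dots>" .
  note dr = lyapunov_drift_bound[OF norm_ge_zero norm_ge_zero norm_ge_zero L pos N c w br bB rat rat2]
  show ?thesis
    using add_mono[OF fast' slow] dr
    unfolding xh_def[symmetric] yh_def[symmetric]
    by (simp add: inner_diff_left distrib_right)
qed

section \<open>Second moments of the noise\<close>

lemma square_integrable_dominated: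
  fixes u :: "'a \<Rightarrow> 'b::euclidean_space" and v :: "'a \<Rightarrow> 'c::real_normed_vector"
  assumes [measurable]: "u \<in> borel_measurable M"
    and v: "integrable M (\<lambda>\<omega>. (norm (v \<omega>))\<^sup>2)" and le: "\<And>\<omega>. norm (u \<omega>) \<le> K * norm (v \<omega>)"
  shows "integrable M (\<lambda>\<omega>. (norm (u \<omega>))\<^sup>2)"
proof (rule Bochner_Integration.integrable_bound[OF integrable_mult_right[OF v, of "K\<^sup>2"]])
  show "AE \<omega> in M. norm ((norm (u \<omega>))\<^sup>2) \<le> norm (K\<^sup>2 * (norm (v \<omega>))\<^sup>2)"
    using power_mono[OF le norm_ge_zero, of _ 2] by (simp add: power_mult_distrib)
qed simp

lemma square_integrable_diff:
  fixes u v :: "'a \<Rightarrow> 'b::euclidean_space"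
  assumes [measurable]: "u \<in> borel_measurable M" "v \<in> borel_measurable M"
    and u: "integrable M (\<lambda>\<omega>. (norm (u \<omega>))\<^sup>2)" and v: "integrable M (\<lambda>\<omega>. (norm (v \<omega>))\<^sup>2)"
  shows "integrable M (\<lambda>\<omega>. (norm (u \<omega> - v \<omega>))\<^sup>2)"
proof (rule Bochner_Integration.integrable_bound[OF integrable_mult_right[OF Bochner_Integration.integrable_add[OF u v], of 2]])
  have "(norm (x - y))\<^sup>2 \<le> 2 * ((norm x)\<^sup>2 + (norm y)\<^sup>2)" for x y :: 'b
  proof -
    have "0 \<le> (norm (x + y))\<^sup>2" by simp
    then show ?thesis unfolding power2_norm_eq_inner by (simp add: inner_simps inner_commute)
  qed
  then show "AE \<omega> in M. norm ((norm (u \<omega> - v \<omega>))\<^sup>2) \<le> norm (2 * ((norm (u \<omega>))\<^sup>2 + (norm (v \<omega>))\<^sup>2))"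
    by (intro AE_I2) simp
qed simp

lemma integrable_inner_of_square_integrable:
  fixes h n :: "'a \<Rightarrow> 'b::euclidean_space"
  assumes [measurable]: "h \<in> borel_measurable M" "n \<in> borel_measurable M"
    and h: "integrable M (\<lambda>\<omega>. (norm (h \<omega>))\<^sup>2)" and n: "integrable M (\<lambda>\<omega>. (norm (n \<omega>))\<^sup>2)"
  shows "integrable M (\<lambda>\<omega>. h \<omega> \<bullet> n \<omega>)"
proof (rule Bochner_Integration.integrable_bound[OF Bochner_Integration.integrable_add[OF h n]])
  show "AE \<omega> in M. norm (h \<omega> \<bullet> n \<omega>) \<le> norm ((norm (h \<omega>))\<^sup>2 + (norm (n \<omega>))\<^sup>2)"
  proof (rule AE_I2)
    fix \<omega>
    have "norm (h \<omega> \<bullet> n \<omega>) \<le> norm (h \<omega>) * norm (n \<omega>)" by (simp add: Cauchy_Schwarz_ineq2)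
    also have "\<dots> \<le> (norm (h \<omega>))\<^sup>2 + (norm (n \<omega>))\<^sup>2"
      using sum_squares_bound[of "norm (h \<omega>)" "norm (n \<omega>)"]
        mult_nonneg_nonneg[OF norm_ge_zero[of "h \<omega>"] norm_ge_zero[of "n \<omega>"]] by linarith
    finally show "norm (h \<omega> \<bullet> n \<omega>) \<le> norm ((norm (h \<omega>))\<^sup>2 + (norm (n \<omega>))\<^sup>2)" by simp
  qed
qed simp

text \<open>The coordinates of a centred noise have conditional mean zero, and a coordinate of \<open>h\<close> can be
  pulled out of the conditional expectation because it is known given \<open>F\<close>. Square integrability is
  what makes the products integrable.\<close>

lemma (in finite_measure_subalgebra) integral_inner_centred_eq_0:
  fixes h n :: "'a \<Rightarrow> real ^ 'n"
  assumes hF: "h \<in> borel_measurable F" and n_meas: "n \<in> borel_measurable M"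
    and h: "integrable M (\<lambda>\<omega>. (norm (h \<omega>))\<^sup>2)" and n: "integrable M (\<lambda>\<omega>. (norm (n \<omega>))\<^sup>2)"
    and centred: "AE \<omega> in M. vec_cond_exp M F n \<omega> = 0"
  shows "(\<integral>\<omega>. h \<omega> \<bullet> n \<omega> \<partial>M) = 0"
proof -
  note [measurable] = n_meas
  have hM [measurable]: "h \<in> borel_measurable M"
    using measurable_from_subalg[OF subalg hF] .
  have hi [measurable]: "(\<lambda>\<omega>. h \<omega> $ i) \<in> borel_measurable F" for i
    by (rule measurable_compose[OF hF]) (intro borel_measurable_continuous_onI continuous_intros)
  have ni [measurable]: "(\<lambda>\<omega>. n \<omega> $ i) \<in> borel_measurable M" for i
    by (rule measurable_compose[OF n_meas]) (intro borel_measurable_continuous_onI continuous_intros)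
  have hiM [measurable]: "(\<lambda>\<omega>. h \<omega> $ i) \<in> borel_measurable M" for i
    by (rule measurable_compose[OF hM]) (intro borel_measurable_continuous_onI continuous_intros)
  have h_i: "integrable M (\<lambda>\<omega>. (norm (h \<omega> $ i))\<^sup>2)" for i
    by (rule square_integrable_dominated[OF hiM h, where K = 1]) (simp add: component_le_norm_cart)
  have n_i: "integrable M (\<lambda>\<omega>. (norm (n \<omega> $ i))\<^sup>2)" for i
    by (rule square_integrable_dominated[OF ni n, where K = 1]) (simp add: component_le_norm_cart)
  have int: "integrable M (\<lambda>\<omega>. h \<omega> $ i * n \<omega> $ i)" for i
    using integrable_inner_of_square_integrable[OF hiM ni h_i n_i] by simp
  have zero: "(\<integral>\<omega>. h \<omega> $ i * n \<omega> $ i \<partial>M) = 0" for i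
  proof -
    have "(\<integral>\<omega>. h \<omega> $ i * n \<omega> $ i \<partial>M) = (\<integral>\<omega>. h \<omega> $ i * real_cond_exp M F (\<lambda>\<omega>. n \<omega> $ i) \<omega> \<partial>M)"
      by (rule real_cond_exp_intg(2)[symmetric]) (use int in measurable)
    also have "\<dots> = (\<integral>\<omega>. 0 \<partial>M)"
    proof (rule integral_cong_AE)
      show "AE \<omega> in M. h \<omega> $ i * real_cond_exp M F (\<lambda>\<omega>. n \<omega> $ i) \<omega> = 0"
        using centred by eventually_elim (simp add: vec_cond_exp_def vec_eq_iff)
    qed measurable
    finally show ?thesis by simp
  qed
  have "(\<integral>\<omega>. h \<omega> \<bullet> n \<omega> \<partial>M) = (\<integral>\<omega>. (\<Sum>i\<in>UNIV. h \<omega> $ i * n \<omega> $ i) \<partial>M)"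
    by (simp add: inner_vec_def)
  also have "\<dots> = 0" using int zero by (subst Bochner_Integration.integral_sum) auto
  finally show ?thesis .
qed

text \<open>The hypothesis uses the conditional expectation of nonnegative functions, which is meaningful
  without integrability. Hence a conditional bound on the variance already forces the noise to be
  square integrable.\<close>

lemma (in finite_measure_subalgebra) second_moment_le_of_nn_cond_exp:
  fixes n :: "'a \<Rightarrow> 'b::euclidean_space"
  assumes [measurable]: "n \<in> borel_measurable M" and B: "0 \<le> B" and prob: "emeasure M (space M) = 1"
    and le: "AE \<omega> in M. nn_cond_exp M F (\<lambda>\<omega>. ennreal ((norm (n \<omega>))\<^sup>2)) \<omega> \<le> ennreal B"
  shows "integrable M (\<lambda>\<omega>. (norm (n \<omega>))\<^sup>2)" and "(\<integral>\<omega>. (norm (n \<omega>))\<^sup>2 \<partial>M) \<le> B"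
proof -
  have "(\<integral>\<^sup>+ \<omega>. ennreal ((norm (n \<omega>))\<^sup>2) \<partial>M)
      = (\<integral>\<^sup>+ \<omega>. 1 * nn_cond_exp M F (\<lambda>\<omega>. ennreal ((norm (n \<omega>))\<^sup>2)) \<omega> \<partial>M)"
    by (subst nn_cond_exp_intg) auto
  also have "\<dots> \<le> (\<integral>\<^sup>+ \<omega>. ennreal B \<partial>M)"
    using le by (intro nn_integral_mono_AE) auto
  also have "\<dots> = ennreal B" using prob by simp
  finally have bnd: "(\<integral>\<^sup>+ \<omega>. ennreal ((norm (n \<omega>))\<^sup>2) \<partial>M) \<le> ennreal B" .
  then show int: "integrable M (\<lambda>\<omega>. (norm (n \<omega>))\<^sup>2)"
    by (intro integrableI_bounded) (auto simp: top_unique le_less_trans)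
  show "(\<integral>\<omega>. (norm (n \<omega>))\<^sup>2 \<partial>M) \<le> B"
    using bnd B by (subst (asm) nn_integral_eq_integral[OF int]) auto
qed

section \<open>The history of the noises\<close>

lemma space_noise_history [simp]: "space (noise_history P X0 Y0 \<xi> \<psi> k) = space P"
  unfolding noise_history_def by (rule space_measure_of) auto

lemma sets_noise_history:
  "sets (noise_history P X0 Y0 \<xi> \<psi> k) = sigma_sets (space P)
     ({X0 -` A \<inter> space P | A. A \<in> sets borel} \<union>
      {Y0 -` A \<inter> space P | A. A \<in> sets borel} \<union>
      {\<xi> j -` A \<inter> space P | j A. j < k \<and> A \<in> sets borel} \<union>
      {\<psi> j -` A \<inter> space P | j A. j < k \<and> A \<in> sets borel})"
  unfolding noise_history_def by (rule sets_measure_of) auto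

lemma subalgebra_noise_history:
  assumes "X0 \<in> borel_measurable P" "Y0 \<in> borel_measurable P"
    and "\<And>j. \<xi> j \<in> borel_measurable P" "\<And>j. \<psi> j \<in> borel_measurable P"
  shows "subalgebra P (noise_history P X0 Y0 \<xi> \<psi> k)"
  unfolding subalgebra_def sets_noise_history
proof (intro conjI sets.sigma_sets_subset)
  show "space (noise_history P X0 Y0 \<xi> \<psi> k) = space P" by simp
qed (use assms in \<open>auto intro: measurable_sets\<close>)

lemma noise_measurable_noise_history:
  assumes "j < k"
  shows "\<xi> j \<in> borel_measurable (noise_history P X0 Y0 \<xi> \<psi> k)"
    and "\<psi> j \<in> borel_measurable (noise_history P X0 Y0 \<xi> \<psi> k)"
  using assms by (auto intro!: measurableI simp: sets_noise_history intro!: sigma_sets.Basic)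

lemma measurable_noise_history_mono:
  assumes "j \<le> k" and h: "h \<in> borel_measurable (noise_history P X0 Y0 \<xi> \<psi> j)"
  shows "h \<in> borel_measurable (noise_history P X0 Y0 \<xi> \<psi> k)"
proof (rule measurable_from_subalg[OF _ h])
  have "{\<xi> i -` A \<inter> space P | i A. i < j \<and> A \<in> sets borel}
      \<subseteq> {\<xi> i -` A \<inter> space P | i A. i < k \<and> A \<in> sets borel}"
    using \<open>j \<le> k\<close> by (blast intro: less_le_trans)
  moreover have "{\<psi> i -` A \<inter> space P | i A. i < j \<and> A \<in> sets borel}
      \<subseteq> {\<psi> i -` A \<inter> space P | i A. i < k \<and> A \<in> sets borel}"
    using \<open>j \<le> k\<close> by (blast intro: less_le_trans)
  ultimately show "subalgebra (noise_history P X0 Y0 \<xi> \<psi> k) (noise_history P X0 Y0 \<xi> \<psi> j)"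
    unfolding subalgebra_def sets_noise_history
    by (intro conjI sigma_sets_mono' Un_mono order_refl) auto
qed

lemma continuous_of_joint_lipschitz:
  fixes h :: "'a::real_normed_vector \<Rightarrow> 'b::real_normed_vector \<Rightarrow> 'c::real_normed_vector"
  assumes lip: "\<And>x1 x2 y1 y2. norm (h x1 y1 - h x2 y2) \<le> L * (norm (x1 - x2) + norm (y1 - y2))"
  shows "continuous_on UNIV (\<lambda>z. h (fst z) (snd z))"
proof (rule continuous_on_subset[OF lipschitz_on_continuous_on])
  show "(2 * \<bar>L\<bar>)-lipschitz_on UNIV (\<lambda>z. h (fst z) (snd z))"
  proof (rule lipschitz_onI)
    fix u v :: "'a \<times> 'b"
    have "norm (h (fst u) (snd u) - h (fst v) (snd v)) \<le> L * (norm (fst u - fst v) + norm (snd u - snd v))"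
      by (rule lip)
    also have "\<dots> \<le> \<bar>L\<bar> * (norm (fst (u - v)) + norm (snd (u - v)))"
      by (auto intro!: mult_right_mono)
    also have "\<dots> \<le> \<bar>L\<bar> * (2 * norm (u - v))"
      using norm_fst_le[of "fst (u - v)" "snd (u - v)"] norm_snd_le[of "snd (u - v)" "fst (u - v)"]
      unfolding prod.collapse by (intro mult_left_mono) linarith+
    finally show "dist (h (fst u) (snd u)) (h (fst v) (snd v)) \<le> 2 * \<bar>L\<bar> * dist u v"
      by (simp add: dist_norm)
  qed simp
qed simp

lemma borel_measurable_joint_lipschitz:
  fixes h :: "'a::euclidean_space \<Rightarrow> 'b::euclidean_space \<Rightarrow> 'c::euclidean_space"
  assumes lip: "\<And>x1 x2 y1 y2. norm (h x1 y1 - h x2 y2) \<le> L * (norm (x1 - x2) + norm (y1 - y2))"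
    and u: "u \<in> borel_measurable M" and v: "v \<in> borel_measurable M"
  shows "(\<lambda>\<omega>. h (u \<omega>) (v \<omega>)) \<in> borel_measurable M"
  by (rule borel_measurable_continuous_Pair[OF u v, where H = h])
    (rule continuous_of_joint_lipschitz[OF lip])

section \<open>The scalar recursion\<close>

text \<open>For \<open>t \<ge> 1\<close> this is Bernoulli's inequality, obtained from the weighted arithmetic-geometric mean
  inequality for \<open>(1 - u) powr t\<close> and \<open>1\<close> with weights \<open>1 / t\<close> and \<open>1 - 1 / t\<close>; for \<open>t \<le> 1\<close> the power is
  at least its base.\<close>

lemma one_minus_powr_ge_linear:
  fixes u t :: real
  assumes u: "0 \<le> u" "u < 1" and t: "0 \<le> t"
  shows "1 - max 1 t * u \<le> (1 - u) powr t"
proof (cases "1 \<le> t")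
  case True
  have "((1 - u) powr t) powr (1 / t) * 1 powr (1 - 1 / t)
      \<le> 1 / t * (1 - u) powr t + (1 - 1 / t) * 1"
    using True u by (intro Youngs_inequality_0) auto
  then have "1 - u \<le> 1 / t * (1 - u) powr t + (1 - 1 / t)"
    using True u by (simp add: powr_powr)
  then have "t * (1 - u) \<le> t * (1 / t * (1 - u) powr t + (1 - 1 / t))"
    using True by (intro mult_left_mono) auto
  also have "\<dots> = (1 - u) powr t + (t - 1)" using True by (simp add: field_simps)
  finally show ?thesis using True by (simp add: max_def algebra_simps)
next
  case False
  then show ?thesis using powr_mono'[of t 1 "1 - u"] u by simp
qed

text \<open>The bound \<open>M / m powr t\<close> propagates since passing from \<open>m - 1\<close> to \<open>m\<close> multiplies it by at least
  \<open>1 - max 1 t / m\<close>, whereas the recursion contracts by \<open>1 - (2 * a + t - 1 / 6) / m\<close>. The difference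
  exceeds \<open>a / 3 / m\<close>, which is the room required by the noise term. For \<open>t < 1\<close> this
  comparison needs \<open>5 / 3 * a + t \<ge> 7 / 6\<close>, which the lower bounds on \<open>a\<close> and \<open>t\<close> provide.\<close>

lemma recursion_step:
  fixes v v' B M a t m :: real
  assumes m: "1 < m" and a: "1 / 2 \<le> a" "a \<le> 1" and t: "2 / 3 \<le> t"
    and v: "0 \<le> v" "v \<le> M / (m - 1) powr t" and M: "0 \<le> M" "3 / a * B \<le> M"
    and step: "v' \<le> (1 - (2 * a + t - 1 / 6) / m) * v + B / m powr (t + 1)"
  shows "v' \<le> M / m powr t"
proof -
  define K where "K = 1 - (2 * a + t - 1 / 6) / m"
  define T where "T = m powr t"
  define s where "s = (1 - 1 / m) powr t"
  have T0: "0 < T" using m by (simp add: T_def)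
  have s0: "0 < s" using m by (simp add: s_def)
  have s1: "s \<le> 1" unfolding s_def using m t by (intro powr_le1) auto
  have mT: "(m - 1) powr t = s * T"
  proof -
    have "m - 1 = (1 - 1 / m) * m" using m by (simp add: field_simps)
    then show ?thesis unfolding s_def T_def using m by (metis powr_mult)
  qed
  have "B \<le> a / 3 * M" using M a by (simp add: field_simps)
  then have "B / (m * T) \<le> (a / 3 * M) / (m * T)" using m T0 by (intro divide_right_mono) auto
  then have B: "B / m powr (t + 1) \<le> (a / 3 / m) * (M / T)"
    using m by (simp add: T_def powr_add mult_ac)
  have am: "a / 3 / m \<le> 1" "0 \<le> a / 3 / m" using m a by (auto simp: field_simps)
  have MT: "0 \<le> M / T" using M T0 by simp
  have Kv: "K * v \<le> (1 - a / 3 / m) * (M / T)"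
    \<comment> \<open>For a negative contraction factor the upper bound on \<open>v\<close> cannot be used, but then its sign is enough.\<close>
  proof (cases "0 \<le> K")
    case True
    have "max 1 t \<le> 2 * a + t - 1 / 6 - a / 3" using a t by auto
    then have "max 1 t * (1 / m) \<le> (2 * a + t - 1 / 6 - a / 3) * (1 / m)"
      using m by (intro mult_right_mono) auto
    moreover have "1 - max 1 t * (1 / m) \<le> s"
      unfolding s_def using m t by (intro one_minus_powr_ge_linear) auto
    moreover have "K = 1 - (2 * a + t - 1 / 6 - a / 3) * (1 / m) - a / 3 / m"
      using m unfolding K_def by (simp add: field_simps)
    ultimately have "K \<le> s - a / 3 / m" by linarith
    moreover have "s * (a / 3 / m) \<le> 1 * (a / 3 / m)" using s1 am by (intro mult_right_mono) auto
    ultimately have Ks: "K \<le> s * (1 - a / 3 / m)" by (simp add: right_diff_distrib)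
    have "K * v \<le> K * (M / (s * T))" using v True by (intro mult_left_mono) (auto simp: mT)
    also have "\<dots> \<le> (s * (1 - a / 3 / m)) * (M / (s * T))"
      using Ks M s0 T0 by (intro mult_right_mono) auto
    also have "\<dots> = (1 - a / 3 / m) * (M / T)" using s0 by simp
    finally show ?thesis .
  next
    case False
    then have "K * v \<le> 0" using v by (simp add: mult_nonpos_nonneg)
    also have "0 \<le> (1 - a / 3 / m) * (M / T)" using am MT by (intro mult_nonneg_nonneg) auto
    finally show ?thesis .
  qed
  have "v' \<le> (1 - a / 3 / m) * (M / T) + (a / 3 / m) * (M / T)"
    using step Kv B unfolding K_def by linarith
  also have "\<dots> = M / T" unfolding distrib_right[symmetric] by simp
  finally show ?thesis by (simp add: T_def)
qed

lemma le_powr_of_root_le: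
  fixes x p k m :: real
  assumes "x powr (1 / p) \<le> k" "k \<le> m" "0 < p"
  shows "x \<le> m powr p"
proof (cases "0 < x")
  case True
  then have "x = (x powr (1 / p)) powr p" using assms by (simp add: powr_powr)
  also have "\<dots> \<le> m powr p" using assms by (intro powr_mono2) auto
  finally show ?thesis .
next
  case False
  then show ?thesis using powr_ge_zero[of m p] by linarith
qed

section \<open>Decay of the Lyapunov function\<close>

theorem theoremS3:
  fixes f :: "real ^ 'd1 \<Rightarrow> real ^ 'd2 \<Rightarrow> real ^ 'd1"
    and g :: "real ^ 'd1 \<Rightarrow> real ^ 'd2 \<Rightarrow> real ^ 'd2"
    and lam :: "real ^ 'd2 \<Rightarrow> real ^ 'd1"
    and xs x0 :: "real ^ 'd1" and ys y0 :: "real ^ 'd2"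
    and Lf Lg Llam \<mu>f \<mu>g :: real
    and P :: "'w measure"
    and \<xi> X :: "nat \<Rightarrow> 'w \<Rightarrow> real ^ 'd1"
    and \<psi> Y :: "nat \<Rightarrow> 'w \<Rightarrow> real ^ 'd2"
    and \<Gamma>11 \<Gamma>22 \<gamma>1 \<gamma>2 :: real
    and \<alpha> \<beta> k0 a b t c C C2 :: real
    and \<alpha>s \<beta>s :: "nat \<Rightarrow> real"
    and V :: "nat \<Rightarrow> 'w \<Rightarrow> real"
    and V0 :: real
  assumes root: "\<And>x y. f x y = 0 \<and> g x y = 0 \<longleftrightarrow> x = xs \<and> y = ys"
    and lam_root: "\<And>x y. f x y = 0 \<longleftrightarrow> x = lam y"
    and lam_lip: "\<And>y1 y2. norm (lam y1 - lam y2) \<le> Llam * norm (y1 - y2)"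
    and f_lip: "\<And>x1 x2 y1 y2.
      norm (f x1 y1 - f x2 y2) \<le> Lf * (norm (x1 - x2) + norm (y1 - y2))"
    and \<mu>f_pos: "\<mu>f > 0"
    and f_mono: "\<And>x1 x2 y.
      (x1 - x2) \<bullet> (f x1 y - f x2 y) \<ge> \<mu>f * (norm (x1 - x2))\<^sup>2"
    and g_lip: "\<And>x1 x2 y1 y2.
      norm (g x1 y1 - g x2 y2) \<le> Lg * (norm (x1 - x2) + norm (y1 - y2))"
    and \<mu>g_pos: "\<mu>g > 0"
    and g_mono: "\<And>y. (y - ys) \<bullet> g (lam y) y \<ge> \<mu>g * (norm (y - ys))\<^sup>2"
    and P: "prob_space P"
    and \<xi>_meas: "\<And>k. \<xi> k \<in> borel_measurable P"
    and \<psi>_meas: "\<And>k. \<psi> k \<in> borel_measurable P"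
    and X_0: "\<And>\<omega>. X 0 \<omega> = x0"
    and Y_0: "\<And>\<omega>. Y 0 \<omega> = y0"
    and X_Suc: "\<And>k \<omega>. X (Suc k) \<omega> = X k \<omega> - \<alpha>s k *\<^sub>R (f (X k \<omega>) (Y k \<omega>) + \<xi> k \<omega>)"
    and Y_Suc: "\<And>k \<omega>. Y (Suc k) \<omega> = Y k \<omega> - \<beta>s k *\<^sub>R (g (X k \<omega>) (Y k \<omega>) + \<psi> k \<omega>)"
    and \<xi>_mean: "\<And>k. AE \<omega> in P.
      vec_cond_exp P (noise_history P (X 0) (Y 0) \<xi> \<psi> k) (\<xi> k) \<omega> = 0"
    and \<psi>_mean: "\<And>k. AE \<omega> in P.
      vec_cond_exp P (noise_history P (X 0) (Y 0) \<xi> \<psi> k) (\<psi> k) \<omega> = 0"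
    and \<Gamma>_nonneg: "\<Gamma>11 \<ge> 0" "\<Gamma>22 \<ge> 0"
    and \<gamma>_nonneg: "\<gamma>1 \<ge> 0" "\<gamma>2 \<ge> 0"
    and \<gamma>_diff: "\<gamma>1 - \<gamma>2 \<in> {-1..<1/2}"
    and \<xi>_var: "AE \<omega> in P. \<forall>k.
      nn_cond_exp P (noise_history P (X 0) (Y 0) \<xi> \<psi> k) (\<lambda>\<omega>'. ennreal ((norm (\<xi> k \<omega>'))\<^sup>2)) \<omega>
        \<le> ennreal (\<Gamma>11 * (real k + 1 + k0) powr (- \<gamma>1))"
    and \<psi>_var: "AE \<omega> in P. \<forall>k.
      nn_cond_exp P (noise_history P (X 0) (Y 0) \<xi> \<psi> k) (\<lambda>\<omega>'. ennreal ((norm (\<psi> k \<omega>'))\<^sup>2)) \<omega>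
        \<le> ennreal (\<Gamma>22 * (real k + 1 + k0) powr (- \<gamma>2))"
    and c_eq: "c = 4 * Lg\<^sup>2 / (\<mu>f * \<mu>g)"
    and V_eq: "\<And>k \<omega>. V k \<omega> =
      c * (\<beta>s k / \<alpha>s k) * (norm (X k \<omega> - lam (Y k \<omega>)))\<^sup>2 + (norm (Y k \<omega> - ys))\<^sup>2"
    and V0_eq: "V0 = c * (\<beta>s 0 / \<alpha>s 0) * (norm (x0 - lam y0))\<^sup>2 + (norm (y0 - ys))\<^sup>2"
    and b_eq: "b = 1"
    and a_eq: "a = (2 - \<gamma>1 + \<gamma>2) / 3"
    and t_eq: "t = (2 + 2 * \<gamma>1 + \<gamma>2) / 3"
    and pos: "\<alpha> > 0" "\<beta> > 0" "k0 > 0"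
    and \<alpha>s_eq: "\<And>k. \<alpha>s k = \<alpha> / (real k + 1 + k0) powr a"
    and \<beta>s_eq: "\<And>k. \<beta>s k = \<beta> / (real k + 1 + k0) powr b"
    and ratio_ge: "\<alpha> / \<beta> \<ge> Max {4 / \<mu>f * (2 * Llam * Lg + 2 / \<mu>g * Llam\<^sup>2 * Lg\<^sup>2 * (Llam + 1)\<^sup>2),
      2 * c, \<mu>g / \<mu>f, 1}"
    and \<beta>_ge: "\<beta> \<ge> 2 / \<mu>g * (2 * a + t)"
    and C_eq: "C = Lf\<^sup>2 + 4 * Llam\<^sup>2 * Lg\<^sup>2 * (\<beta>\<^sup>2 / \<alpha>\<^sup>2) + 2 * Lf * Llam * Lg * (\<beta> / \<alpha>)
      + 2 / \<mu>g * Lf\<^sup>2 * Llam\<^sup>2 * Lg\<^sup>2 * (Llam + 1)\<^sup>2 * \<beta>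
      + 1 / c * Lg\<^sup>2 * (Llam + 2) * (\<beta> / \<alpha>)
      + 4 * c * Llam\<^sup>2 * Lg\<^sup>2 * (Llam + 1)\<^sup>2 * (\<beta> ^ 3 / \<alpha> ^ 3)
      + Lg\<^sup>2 * (2 * Llam\<^sup>2 + Llam + 3) * (\<beta>\<^sup>2 / \<alpha>\<^sup>2)"
    and k0_ge: "k0 \<ge> Max {\<alpha> powr (1 / a), (\<alpha>\<^sup>2 / \<beta>) powr (1 / (2 * a - 1)),
      1 / (2 powr (1 / t) - 1), 1 / (2 powr (1 / (2 * a)) - 1),
      (6 * C * \<alpha>\<^sup>2) powr (1 / (2 * a - 1))}"
    and C2_eq: "C2 = 2 * c * \<alpha> * \<beta> * \<Gamma>11
      + \<beta> ^ 3 / \<alpha>\<^sup>2 * (c * (2 / \<mu>f * Llam\<^sup>2 + 2 / \<mu>f * Lf\<^sup>2 * Llam\<^sup>2 + 2 * Llam\<^sup>2) + 1) * \<Gamma>22"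
  shows "(\<exists>M. M \<ge> Max {3 * k0 powr t * V0, 3 / a * C2}) \<and>
    (\<forall>M. M \<ge> Max {3 * k0 powr t * V0, 3 / a * C2} \<longrightarrow>
      (\<forall>k::nat. integrable P (V k) \<and>
        (\<integral>\<omega>. V k \<omega> \<partial>P) \<le> M / (real k + k0) powr t))"
proof -
  interpret P: prob_space P by (rule P)

  have exists_M: "\<exists>M. M \<ge> Max {3 * k0 powr t * V0, 3 / a * C2}" by blast

  \<comment> \<open>The Lipschitz constants are nonnegative as the spaces contain nonzero vectors.\<close>
  obtain e1 :: "real ^ 'd1" and e2 :: "real ^ 'd2" where e: "norm e1 = 1" "norm e2 = 1"
    using vector_choose_size[of 1] by (metis zero_le_one)
  have Lf0: "0 \<le> Lf" using f_lip[of e1 _ 0 _] order_trans[OF norm_ge_zero f_lip[of e1 0 0 0]] e by simp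
  have Lg0: "0 \<le> Lg" using order_trans[OF norm_ge_zero g_lip[of e1 0 0 0]] e by simp
  have Llam0: "0 \<le> Llam" using order_trans[OF norm_ge_zero lam_lip[of e2 0]] e by simp
  have f_root: "f (lam y) y = 0" for y using lam_root[of "lam y" y] by simp
  have xs_eq: "lam ys = xs" using root[of xs ys] lam_root[of xs ys] by simp
  have g_root: "g (lam ys) ys = 0" using root[of xs ys] xs_eq by simp
  \<comment> \<open>If \<open>Lg\<close> were zero then \<open>g\<close> would vanish identically along \<open>lam\<close>, against the lower bound on \<open>(y - ys) \<bullet> g (lam y) y\<close>.
    Without this, \<open>c\<close> could be zero and \<open>V\<close> would not control the fast error.\<close>
  have "Lg \<noteq> 0"
  proof
    assume "Lg = 0"
    then have "g (lam (ys + e2)) (ys + e2) = 0"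
      using g_lip[of "lam (ys + e2)" "ys + e2" "lam ys" ys] g_root by simp
    then show False using g_mono[of "ys + e2"] e \<mu>g_pos by simp
  qed
  then have c0: "0 < c" unfolding c_eq using \<mu>f_pos \<mu>g_pos by simp

  have a: "1 / 2 < a" "a \<le> 1" using \<gamma>_diff unfolding a_eq by auto
  have t: "2 / 3 \<le> t" using \<gamma>_nonneg unfolding t_eq by auto
  have ratio: "4 / \<mu>f * (2 * Llam * Lg + 2 / \<mu>g * Llam\<^sup>2 * Lg\<^sup>2 * (Llam + 1)\<^sup>2) \<le> \<alpha> / \<beta>"
    "2 * c \<le> \<alpha> / \<beta>" "\<mu>g / \<mu>f \<le> \<alpha> / \<beta>" "1 \<le> \<alpha> / \<beta>"
    using ratio_ge by auto
  have k0: "\<alpha> powr (1 / a) \<le> k0" "(\<alpha>\<^sup>2 / \<beta>) powr (1 / (2 * a - 1)) \<le> k0"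
    "(6 * C * \<alpha>\<^sup>2) powr (1 / (2 * a - 1)) \<le> k0"
    using k0_ge by auto
  define r where "r = \<beta> / \<alpha>"
  have r0: "0 < r" using pos by (simp add: r_def)
  have C: "C = drift_const Lf Lg Llam \<mu>g c r \<beta>"
    unfolding C_eq drift_const_def r_def by (simp add: power_divide)

  define m where "m k = real k + 1 + k0" for k
  define w where "w k = c * (\<beta>s k / \<alpha>s k)" for k
  have m1: "1 < m k" and mk0: "k0 \<le> m k" and m0: "0 < m k" for k
    using pos by (auto simp: m_def)
  have \<alpha>s: "\<alpha>s k = \<alpha> / m k powr a" and \<beta>s: "\<beta>s k = \<beta> / m k" for k
    using m0[of k] by (auto simp: \<alpha>s_eq \<beta>s_eq b_eq m_def)
  have \<alpha>0: "0 < \<alpha>s k" and \<beta>0: "0 < \<beta>s k" for k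
    using pos m0[of k] by (auto simp: \<alpha>s \<beta>s)
  have \<alpha>1: "\<alpha>s k \<le> 1" for k
    using le_powr_of_root_le[OF k0(1) mk0] a m0[of k] by (simp add: \<alpha>s field_simps)
  have sq: "(\<alpha>s k)\<^sup>2 = \<alpha>\<^sup>2 / (m k * m k powr (2 * a - 1))" for k
  proof -
    have "(m k powr a)\<^sup>2 = m k powr (1 + (2 * a - 1))"
      using m0[of k] by (simp add: power2_eq_square flip: powr_add)
    also have "\<dots> = m k * m k powr (2 * a - 1)" unfolding powr_add using m0[of k] by simp
    finally show ?thesis by (simp add: \<alpha>s power_divide)
  qed
  have \<alpha>sq_le: "(\<alpha>s k)\<^sup>2 \<le> \<beta>s k" for k
    using le_powr_of_root_le[OF k0(2) mk0] a m0[of k] pos by (simp add: sq \<beta>s field_simps)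
  have C\<alpha>sq_le: "C * (\<alpha>s k)\<^sup>2 \<le> 1 / 6 / m k" for k
    using le_powr_of_root_le[OF k0(3) mk0] a m0[of k] by (simp add: sq field_simps)
  have quot: "\<beta>s k / \<alpha>s k = r * m k powr (a - 1)" for k
    using m0[of k] pos by (simp add: \<alpha>s \<beta>s r_def powr_diff field_simps)
  have quot_le: "\<beta>s k / \<alpha>s k \<le> r" for k
    unfolding quot using m1[of k] a r0 powr_mono[of "a - 1" 0 "m k"] by (simp add: mult_left_le)
  have \<beta>r: "\<beta>s k \<le> r * \<alpha>s k" for k
    using quot_le[of k] \<alpha>0[of k] by (simp add: field_simps)
  have \<beta>\<beta>: "\<beta>s k \<le> \<beta>" for k
    using m1[of k] pos by (simp add: \<beta>s field_simps)
  have w0: "0 < w k" for k unfolding w_def using c0 \<alpha>0[of k] \<beta>0[of k] by simp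
  have w_half: "w k \<le> 1 / 2" for k
  proof -
    have "w k \<le> c * r" unfolding w_def using quot_le c0 by (intro mult_left_mono) auto
    also have "\<dots> \<le> 1 / 2" using ratio(2) pos by (simp add: r_def field_simps)
    finally show ?thesis .
  qed
  have w_Suc: "w (Suc k) \<le> w k" for k
  proof -
    have "m (Suc k) powr (a - 1) \<le> m k powr (a - 1)"
      using m0[of k] a by (intro powr_mono2') (auto simp: m_def)
    then show ?thesis unfolding w_def quot using c0 r0 by (intro mult_left_mono) auto
  qed
  have rat1: "\<beta>s k * (2 * Llam * Lg + 2 / \<mu>g * Llam\<^sup>2 * Lg\<^sup>2 * (Llam + 1)\<^sup>2) \<le> \<alpha>s k * \<mu>f / 4" for k
  proof -
    define S where "S = 2 * Llam * Lg + 2 / \<mu>g * Llam\<^sup>2 * Lg\<^sup>2 * (Llam + 1)\<^sup>2"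
    have S0: "0 \<le> S" unfolding S_def using Llam0 Lg0 \<mu>g_pos by auto
    have rS: "r * S \<le> \<mu>f / 4"
      using ratio(1) pos \<mu>f_pos unfolding S_def[symmetric] r_def by (simp add: field_simps)
    have "\<beta>s k * S \<le> (r * \<alpha>s k) * S" using \<beta>r S0 by (intro mult_right_mono) auto
    also have "\<dots> \<le> \<alpha>s k * (\<mu>f / 4)"
      using mult_left_mono[OF rS, of "\<alpha>s k"] \<alpha>0[of k] by (simp add: mult_ac)
    finally show ?thesis by (simp add: S_def)
  qed
  have rat2: "\<beta>s k * \<mu>g \<le> \<alpha>s k * \<mu>f" for k
  proof -
    have "r * \<mu>g \<le> \<mu>f" using ratio(3) pos \<mu>f_pos by (simp add: r_def field_simps)
    then have "\<alpha>s k * (r * \<mu>g) \<le> \<alpha>s k * \<mu>f" using \<alpha>0[of k] by (intro mult_left_mono) auto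
    moreover have "\<beta>s k * \<mu>g \<le> (r * \<alpha>s k) * \<mu>g" using \<beta>r \<mu>g_pos by (intro mult_right_mono) auto
    ultimately show ?thesis by (simp add: mult_ac)
  qed
  \<comment> \<open>The condition on \<open>\<beta>\<close> gives the rate \<open>2 * a + t\<close>, of which the second-order drift spends \<open>1 / 6\<close>.\<close>
  have contraction: "1 - \<beta>s k * \<mu>g / 2 + C * (\<alpha>s k)\<^sup>2 \<le> 1 - (2 * a + t - 1 / 6) / m k" for k
  proof -
    have "2 * a + t \<le> \<beta> * \<mu>g / 2" using \<beta>_ge \<mu>g_pos by (simp add: field_simps)
    then have "(2 * a + t) / m k \<le> (\<beta> * \<mu>g / 2) / m k" using m0[of k] by (intro divide_right_mono) auto
    then show ?thesis using C\<alpha>sq_le[of k] by (simp add: \<beta>s diff_divide_distrib)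
  qed

  define D where "D k = w k * (2 / \<mu>f * (Llam * \<beta>s k)\<^sup>2 * (1 / \<alpha>s k + \<alpha>s k * Lf\<^sup>2)
      + 2 * (Llam * \<beta>s k)\<^sup>2) + (\<beta>s k)\<^sup>2" for k
  define \<kappa> where "\<kappa> = c * (2 / \<mu>f * Llam\<^sup>2 + 2 / \<mu>f * Lf\<^sup>2 * Llam\<^sup>2 + 2 * Llam\<^sup>2) + 1"
  have D0: "0 \<le> D k" for k
    unfolding D_def using w0[of k] \<alpha>0[of k] \<mu>f_pos
    by (intro add_nonneg_nonneg mult_nonneg_nonneg) auto
  \<comment> \<open>The leading part of the coefficient of the squared slow noise is of order \<open>\<beta>s ^ 3 / \<alpha>s\<^sup>2\<close>. The other
    parts are brought to that order by \<open>\<alpha>s \<le> 1\<close> and \<open>\<alpha>s\<^sup>2 \<le> \<beta>s\<close>.\<close>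
  have D_le: "D k \<le> \<beta>s k ^ 3 / (\<alpha>s k)\<^sup>2 * \<kappa>" for k
  proof -
    have "\<alpha>s k * \<alpha>s k \<le> 1" using \<alpha>0[of k] \<alpha>1[of k] by (simp add: mult_le_one)
    then have "\<alpha>s k \<le> 1 / \<alpha>s k" using \<alpha>0[of k] by (simp add: field_simps)
    then have "1 / \<alpha>s k + \<alpha>s k * Lf\<^sup>2 \<le> 1 / \<alpha>s k + 1 / \<alpha>s k * Lf\<^sup>2"
      by (intro add_left_mono mult_right_mono) auto
    then have "2 / \<mu>f * (Llam * \<beta>s k)\<^sup>2 * (1 / \<alpha>s k + \<alpha>s k * Lf\<^sup>2)
        \<le> 2 / \<mu>f * (Llam * \<beta>s k)\<^sup>2 * (1 / \<alpha>s k + 1 / \<alpha>s k * Lf\<^sup>2)"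
      using \<mu>f_pos by (intro mult_left_mono) auto
    moreover have "2 * (Llam * \<beta>s k)\<^sup>2 * 1 \<le> 2 * (Llam * \<beta>s k)\<^sup>2 * (1 / \<alpha>s k)"
      using \<alpha>1[of k] \<alpha>0[of k] by (intro mult_left_mono) auto
    ultimately have "w k * (2 / \<mu>f * (Llam * \<beta>s k)\<^sup>2 * (1 / \<alpha>s k + \<alpha>s k * Lf\<^sup>2) + 2 * (Llam * \<beta>s k)\<^sup>2)
        \<le> w k * (2 / \<mu>f * (Llam * \<beta>s k)\<^sup>2 * (1 / \<alpha>s k + 1 / \<alpha>s k * Lf\<^sup>2)
          + 2 * (Llam * \<beta>s k)\<^sup>2 * (1 / \<alpha>s k))"
      using w0[of k] by (intro mult_left_mono) auto
    also have "\<dots> = \<beta>s k ^ 3 / (\<alpha>s k)\<^sup>2 * (\<kappa> - 1)"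
      unfolding w_def \<kappa>_def power_mult_distrib using \<alpha>0[of k] \<mu>f_pos
      by (simp add: power2_eq_square power3_eq_cube field_simps)
    finally have "D k \<le> \<beta>s k ^ 3 / (\<alpha>s k)\<^sup>2 * (\<kappa> - 1) + (\<beta>s k)\<^sup>2" unfolding D_def by simp
    moreover have "(\<beta>s k)\<^sup>2 \<le> \<beta>s k ^ 3 / (\<alpha>s k)\<^sup>2"
      using mult_left_mono[OF \<alpha>sq_le[of k], of "(\<beta>s k)\<^sup>2"] \<alpha>0[of k]
      by (simp add: power2_eq_square power3_eq_cube field_simps)
    ultimately show ?thesis by (simp add: right_diff_distrib)
  qed
  define B1 where "B1 k = \<Gamma>11 * m k powr (- \<gamma>1)" for k
  define B2 where "B2 k = \<Gamma>22 * m k powr (- \<gamma>2)" for k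
  have B0: "0 \<le> B1 k" "0 \<le> B2 k" for k using \<Gamma>_nonneg by (auto simp: B1_def B2_def)
  \<comment> \<open>The exponents balance: \<open>a + 1 + \<gamma>1\<close> and \<open>3 - 2 * a + \<gamma>2\<close> are both equal to \<open>t + 1\<close>, which is the reason
    for the choice of \<open>a\<close> and \<open>t\<close>.\<close>
  have noise: "2 * w k * (\<alpha>s k)\<^sup>2 * B1 k + D k * B2 k \<le> C2 / m k powr (t + 1)" for k
  proof -
    have "2 * w k * (\<alpha>s k)\<^sup>2 * B1 k = 2 * c * (\<alpha>s k * \<beta>s k) * B1 k"
      using \<alpha>0[of k] by (simp add: w_def power2_eq_square)
    also have "\<alpha>s k * \<beta>s k = \<alpha> * \<beta> * m k powr (- a - 1)"
      using m0[of k] by (simp add: \<alpha>s \<beta>s powr_diff powr_minus_divide)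
    also have "2 * c * (\<alpha> * \<beta> * m k powr (- a - 1)) * B1 k
        = 2 * c * \<alpha> * \<beta> * \<Gamma>11 * m k powr (- a - 1 + - \<gamma>1)"
      unfolding B1_def powr_add by (simp add: mult_ac)
    also have "- a - 1 + - \<gamma>1 = - (t + 1)" unfolding a_eq t_eq by (simp add: field_simps)
    finally have n1: "2 * w k * (\<alpha>s k)\<^sup>2 * B1 k = 2 * c * \<alpha> * \<beta> * \<Gamma>11 * m k powr (- (t + 1))" .
    have "D k * B2 k \<le> \<beta>s k ^ 3 / (\<alpha>s k)\<^sup>2 * \<kappa> * B2 k"
      using D_le B0 by (intro mult_right_mono) auto
    also have "\<beta>s k ^ 3 / (\<alpha>s k)\<^sup>2 = \<beta> ^ 3 / \<alpha>\<^sup>2 * m k powr (2 * a - 3)"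
    proof -
      have "(m k powr a)\<^sup>2 = m k powr (2 * a)"
        using m0[of k] by (simp add: power2_eq_square flip: powr_add)
      moreover have "m k ^ 3 = m k powr 3" using m0[of k] by (simp add: powr_numeral)
      ultimately show ?thesis
        using m0[of k] pos by (simp add: \<alpha>s \<beta>s power_divide powr_diff)
    qed
    also have "\<beta> ^ 3 / \<alpha>\<^sup>2 * m k powr (2 * a - 3) * \<kappa> * B2 k
        = \<beta> ^ 3 / \<alpha>\<^sup>2 * \<kappa> * \<Gamma>22 * m k powr (2 * a - 3 + - \<gamma>2)"
      unfolding B2_def powr_add by (simp add: mult_ac)
    also have "2 * a - 3 + - \<gamma>2 = - (t + 1)" unfolding a_eq t_eq by (simp add: field_simps)
    finally have "2 * w k * (\<alpha>s k)\<^sup>2 * B1 k + D k * B2 k \<le> C2 * m k powr (- (t + 1))"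
      unfolding n1 C2_eq \<kappa>_def[symmetric] by (simp add: distrib_right)
    then show ?thesis unfolding powr_minus_divide by simp
  qed

  define Q where "Q k = noise_history P (X 0) (Y 0) \<xi> \<psi> k" for k
  have X0_fun: "X 0 = (\<lambda>_. x0)" and Y0_fun: "Y 0 = (\<lambda>_. y0)" using X_0 Y_0 by auto
  have subalg: "subalgebra P (Q k)" for k
    unfolding Q_def by (rule subalgebra_noise_history) (use \<xi>_meas \<psi>_meas in \<open>auto simp: X0_fun Y0_fun\<close>)
  have Q: "finite_measure_subalgebra P (Q k)" for k
    unfolding finite_measure_subalgebra_def finite_measure_subalgebra_axioms_def
    using subalg P.finite_measure_axioms by simp
  have lam_cont: "continuous_on UNIV lam"
    using lam_lip Llam0
    by (intro lipschitz_on_continuous_on[of Llam] lipschitz_onI) (auto simp: dist_norm)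
  have XY: "X k \<in> borel_measurable (Q k) \<and> Y k \<in> borel_measurable (Q k)" for k
  proof (induction k)
    case 0
    show ?case by (simp add: X0_fun Y0_fun)
  next
    case (Suc k)
    have [measurable]: "X k \<in> borel_measurable (Q (Suc k))" "Y k \<in> borel_measurable (Q (Suc k))"
      using Suc measurable_noise_history_mono[of k "Suc k"] unfolding Q_def by auto
    have [measurable]: "\<xi> k \<in> borel_measurable (Q (Suc k))" "\<psi> k \<in> borel_measurable (Q (Suc k))"
      unfolding Q_def by (rule noise_measurable_noise_history; simp)+
    have [measurable]: "(\<lambda>\<omega>. f (X k \<omega>) (Y k \<omega>)) \<in> borel_measurable (Q (Suc k))"
      "(\<lambda>\<omega>. g (X k \<omega>) (Y k \<omega>)) \<in> borel_measurable (Q (Suc k))"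
      by (rule borel_measurable_joint_lipschitz[OF f_lip] borel_measurable_joint_lipschitz[OF g_lip];
          measurable)+
    have "X (Suc k) = (\<lambda>\<omega>. X k \<omega> - \<alpha>s k *\<^sub>R (f (X k \<omega>) (Y k \<omega>) + \<xi> k \<omega>))"
      "Y (Suc k) = (\<lambda>\<omega>. Y k \<omega> - \<beta>s k *\<^sub>R (g (X k \<omega>) (Y k \<omega>) + \<psi> k \<omega>))"
      using X_Suc Y_Suc by auto
    then show ?case by simp
  qed
  define xh where "xh k \<omega> = X k \<omega> - lam (Y k \<omega>)" for k \<omega>
  define yh where "yh k \<omega> = Y k \<omega> - ys" for k \<omega>
  define F where "F k \<omega> = f (X k \<omega>) (Y k \<omega>)" for k \<omega>
  define G where "G k \<omega> = g (X k \<omega>) (Y k \<omega>)" for k \<omega>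
  define G0 where "G0 k \<omega> = g (lam (Y k \<omega>)) (Y k \<omega>)" for k \<omega>
  have lamY: "(\<lambda>\<omega>. lam (Y k \<omega>)) \<in> borel_measurable (Q k)" for k
    using measurable_compose[OF conjunct2[OF XY] borel_measurable_continuous_onI[OF lam_cont]] .
  have measQ: "xh k \<in> borel_measurable (Q k)" "yh k \<in> borel_measurable (Q k)"
    "F k \<in> borel_measurable (Q k)" "G k \<in> borel_measurable (Q k)" "G0 k \<in> borel_measurable (Q k)" for k
  proof -
    note [measurable] = conjunct1[OF XY[of k]] conjunct2[OF XY[of k]] lamY[of k]
    show "xh k \<in> borel_measurable (Q k)" "yh k \<in> borel_measurable (Q k)"
      unfolding xh_def yh_def by measurable
    show "F k \<in> borel_measurable (Q k)" "G k \<in> borel_measurable (Q k)" "G0 k \<in> borel_measurable (Q k)"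
      unfolding F_def G_def G0_def
      by (rule borel_measurable_joint_lipschitz[OF f_lip] borel_measurable_joint_lipschitz[OF g_lip];
          measurable)+
  qed
  have V: "V k \<omega> = w k * (norm (xh k \<omega>))\<^sup>2 + (norm (yh k \<omega>))\<^sup>2" for k \<omega>
    by (simp add: V_eq w_def xh_def yh_def)
  have V0: "0 \<le> V k \<omega>" for k \<omega> unfolding V using w0[of k] by simp
  define h1 where "h1 k \<omega> = (- 2 * w k * \<alpha>s k) *\<^sub>R (xh k \<omega> - \<alpha>s k *\<^sub>R F k \<omega>)" for k \<omega>
  define h2 where "h2 k \<omega> = (4 * w k * (Llam * \<beta>s k)\<^sup>2) *\<^sub>R G k \<omega>
      - (2 * \<beta>s k) *\<^sub>R (yh k \<omega> - \<beta>s k *\<^sub>R G k \<omega>)" for k \<omega>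
  have pathwise: "V (Suc k) \<omega> \<le> (1 - \<beta>s k * \<mu>g / 2 + C * (\<alpha>s k)\<^sup>2) * V k \<omega>
      + 2 * w k * (\<alpha>s k)\<^sup>2 * (norm (\<xi> k \<omega>))\<^sup>2 + D k * (norm (\<psi> k \<omega>))\<^sup>2
      + h1 k \<omega> \<bullet> \<xi> k \<omega> + h2 k \<omega> \<bullet> \<psi> k \<omega>" for k \<omega>
    unfolding V C D_def h1_def h2_def F_def G_def xh_def yh_def
    by (rule lyapunov_step[OF f_root g_root lam_lip f_lip f_mono g_lip g_mono Lf0 Lg0 Llam0
          \<mu>f_pos \<mu>g_pos c0 \<alpha>0 \<beta>0 c_eq w_def w_half w_Suc \<beta>r \<beta>\<beta> rat1 rat2 X_Suc Y_Suc])

  \<comment> \<open>Integrability of \<open>V\<close> has to be carried along the induction, since it makes the coefficients of the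
    linear noise terms square integrable.\<close>
  have step: "integrable P (V (Suc k)) \<and>
      (\<integral>\<omega>. V (Suc k) \<omega> \<partial>P) \<le> (1 - (2 * a + t - 1 / 6) / m k) * (\<integral>\<omega>. V k \<omega> \<partial>P) + C2 / m k powr (t + 1)"
    if Vk: "integrable P (V k)" for k
  proof -
    interpret Q: finite_measure_subalgebra P "Q k" by (rule Q)
    note [measurable] = measQ[of k, THEN measurable_from_subalg[OF subalg]]
      measQ(1,2)[of "Suc k", THEN measurable_from_subalg[OF subalg]] \<xi>_meas \<psi>_meas
    have "integrable P (\<lambda>\<omega>. w k * (norm (xh k \<omega>))\<^sup>2)"
      using w0[of k] by (intro Bochner_Integration.integrable_bound[OF Vk]) (auto simp: V)
    then have xh2: "integrable P (\<lambda>\<omega>. (norm (xh k \<omega>))\<^sup>2)" using w0[of k] by simp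
    have yh2: "integrable P (\<lambda>\<omega>. (norm (yh k \<omega>))\<^sup>2)"
      using w0[of k] by (intro Bochner_Integration.integrable_bound[OF Vk]) (auto simp: V)
    have F2: "integrable P (\<lambda>\<omega>. (norm (F k \<omega>))\<^sup>2)"
    proof (rule square_integrable_dominated[OF _ xh2])
      show "norm (F k \<omega>) \<le> Lf * norm (xh k \<omega>)" for \<omega>
        using f_lip[of "X k \<omega>" "Y k \<omega>" "lam (Y k \<omega>)" "Y k \<omega>"] f_root[of "Y k \<omega>"]
        by (simp add: xh_def F_def)
    qed measurable
    have GG2: "integrable P (\<lambda>\<omega>. (norm (G0 k \<omega> - G k \<omega>))\<^sup>2)"
    proof (rule square_integrable_dominated[OF _ xh2])
      show "norm (G0 k \<omega> - G k \<omega>) \<le> Lg * norm (xh k \<omega>)" for \<omega>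
        using g_lip[of "X k \<omega>" "Y k \<omega>" "lam (Y k \<omega>)" "Y k \<omega>"]
        by (simp add: xh_def G_def G0_def norm_minus_commute)
    qed measurable
    have G02: "integrable P (\<lambda>\<omega>. (norm (G0 k \<omega>))\<^sup>2)"
    proof (rule square_integrable_dominated[OF _ yh2])
      show "norm (G0 k \<omega>) \<le> Lg * (Llam + 1) * norm (yh k \<omega>)" for \<omega>
      proof -
        have "norm (G0 k \<omega>) \<le> Lg * (norm (lam (Y k \<omega>) - lam ys) + norm (yh k \<omega>))"
          using g_lip[of "lam (Y k \<omega>)" "Y k \<omega>" "lam ys" ys] g_root by (simp add: yh_def G0_def)
        also have "\<dots> \<le> Lg * (Llam * norm (yh k \<omega>) + norm (yh k \<omega>))"
          using lam_lip[of "Y k \<omega>" ys] Lg0 by (intro mult_left_mono add_mono) (auto simp: yh_def)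
        finally show ?thesis by (simp add: algebra_simps)
      qed
    qed measurable
    have G2: "integrable P (\<lambda>\<omega>. (norm (G k \<omega>))\<^sup>2)"
      using square_integrable_diff[OF _ _ G02 GG2] by simp
    have scale: "integrable P (\<lambda>\<omega>. (norm (s *\<^sub>R u \<omega>))\<^sup>2)" if "integrable P (\<lambda>\<omega>. (norm (u \<omega>))\<^sup>2)"
      for s :: real and u :: "'w \<Rightarrow> 'z::real_normed_vector"
      using that by (simp add: power_mult_distrib)
    have h1Q: "h1 k \<in> borel_measurable (Q k)" and h2Q: "h2 k \<in> borel_measurable (Q k)"
      unfolding h1_def h2_def using measQ[of k] by measurable
    note [measurable] = measurable_from_subalg[OF subalg h1Q] measurable_from_subalg[OF subalg h2Q]
    have h12: "integrable P (\<lambda>\<omega>. (norm (h1 k \<omega>))\<^sup>2)"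
      unfolding h1_def by (intro scale square_integrable_diff xh2 F2; measurable)
    have h22: "integrable P (\<lambda>\<omega>. (norm (h2 k \<omega>))\<^sup>2)"
      unfolding h2_def by (intro scale square_integrable_diff yh2 G2; measurable)
    have \<xi>AE: "AE \<omega> in P. nn_cond_exp P (Q k) (\<lambda>\<omega>. ennreal ((norm (\<xi> k \<omega>))\<^sup>2)) \<omega> \<le> ennreal (B1 k)"
      using \<xi>_var unfolding Q_def B1_def m_def by eventually_elim blast
    have \<psi>AE: "AE \<omega> in P. nn_cond_exp P (Q k) (\<lambda>\<omega>. ennreal ((norm (\<psi> k \<omega>))\<^sup>2)) \<omega> \<le> ennreal (B2 k)"
      using \<psi>_var unfolding Q_def B2_def m_def by eventually_elim blast
    note \<xi>2 = Q.second_moment_le_of_nn_cond_exp[OF \<xi>_meas B0(1) P.emeasure_space_1 \<xi>AE]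
    note \<psi>2 = Q.second_moment_le_of_nn_cond_exp[OF \<psi>_meas B0(2) P.emeasure_space_1 \<psi>AE]
    have i1: "integrable P (\<lambda>\<omega>. h1 k \<omega> \<bullet> \<xi> k \<omega>)"
      by (rule integrable_inner_of_square_integrable[OF _ _ h12 \<xi>2(1)]) measurable
    have i2: "integrable P (\<lambda>\<omega>. h2 k \<omega> \<bullet> \<psi> k \<omega>)"
      by (rule integrable_inner_of_square_integrable[OF _ _ h22 \<psi>2(1)]) measurable
    have z1: "(\<integral>\<omega>. h1 k \<omega> \<bullet> \<xi> k \<omega> \<partial>P) = 0"
      using Q.integral_inner_centred_eq_0[OF h1Q \<xi>_meas h12 \<xi>2(1)] \<xi>_mean[of k] unfolding Q_def by blast
    have z2: "(\<integral>\<omega>. h2 k \<omega> \<bullet> \<psi> k \<omega> \<partial>P) = 0"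
      using Q.integral_inner_centred_eq_0[OF h2Q \<psi>_meas h22 \<psi>2(1)] \<psi>_mean[of k] unfolding Q_def by blast
    define \<rho> where "\<rho> = 1 - \<beta>s k * \<mu>g / 2 + C * (\<alpha>s k)\<^sup>2"
    define R where "R \<omega> = \<rho> * V k \<omega>
      + 2 * w k * (\<alpha>s k)\<^sup>2 * (norm (\<xi> k \<omega>))\<^sup>2 + D k * (norm (\<psi> k \<omega>))\<^sup>2
      + h1 k \<omega> \<bullet> \<xi> k \<omega> + h2 k \<omega> \<bullet> \<psi> k \<omega>" for \<omega>
    have VR: "V (Suc k) \<omega> \<le> R \<omega>" for \<omega> unfolding R_def \<rho>_def by (rule pathwise)
    have R: "integrable P R"
      unfolding R_def using Vk \<xi>2(1) \<psi>2(1) i1 i2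
      by (intro Bochner_Integration.integrable_add integrable_mult_right)
    have VS: "integrable P (V (Suc k))"
    proof (rule Bochner_Integration.integrable_bound[OF R])
      have "V (Suc k) = (\<lambda>\<omega>. w (Suc k) * (norm (xh (Suc k) \<omega>))\<^sup>2 + (norm (yh (Suc k) \<omega>))\<^sup>2)"
        using V by auto
      then show "V (Suc k) \<in> borel_measurable P" by simp
      show "AE \<omega> in P. norm (V (Suc k) \<omega>) \<le> norm (R \<omega>)"
        using V0[of "Suc k"] VR by (intro AE_I2) (simp add: abs_of_nonneg order_trans[OF VR abs_ge_self])
    qed
    have "(\<integral>\<omega>. V (Suc k) \<omega> \<partial>P) \<le> (\<integral>\<omega>. R \<omega> \<partial>P)"
      using VS R VR by (rule integral_mono)
    also have "\<dots> = \<rho> * (\<integral>\<omega>. V k \<omega> \<partial>P)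
        + 2 * w k * (\<alpha>s k)\<^sup>2 * (\<integral>\<omega>. (norm (\<xi> k \<omega>))\<^sup>2 \<partial>P) + D k * (\<integral>\<omega>. (norm (\<psi> k \<omega>))\<^sup>2 \<partial>P)"
      unfolding R_def using Vk \<xi>2(1) \<psi>2(1) i1 i2 z1 z2 by simp
    also have "\<dots> \<le> (1 - (2 * a + t - 1 / 6) / m k) * (\<integral>\<omega>. V k \<omega> \<partial>P)
        + 2 * w k * (\<alpha>s k)\<^sup>2 * B1 k + D k * B2 k"
      unfolding \<rho>_def using contraction[of k] \<xi>2(2) \<psi>2(2) w0[of k] D0[of k] V0[of k]
      by (intro add_mono mult_right_mono mult_left_mono) auto
    also have "\<dots> \<le> (1 - (2 * a + t - 1 / 6) / m k) * (\<integral>\<omega>. V k \<omega> \<partial>P) + C2 / m k powr (t + 1)"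
      using noise[of k] by linarith
    finally show ?thesis using VS by blast
  qed

  have V_0: "V 0 = (\<lambda>_. V0)" unfolding V0_eq using V_eq X_0 Y_0 by auto
  have "integrable P (V k) \<and> (\<integral>\<omega>. V k \<omega> \<partial>P) \<le> M / (real k + k0) powr t"
    if M: "M \<ge> Max {3 * k0 powr t * V0, 3 / a * C2}" for M k
  proof -
    have V00: "0 \<le> V0" using V0[of 0] V_0 by simp
    have M1: "3 * k0 powr t * V0 \<le> M" and M2: "3 / a * C2 \<le> M" using M by auto
    have kV: "0 \<le> k0 powr t * V0" using V00 by simp
    have M0: "0 \<le> M" using M1 kV by linarith
    show ?thesis
    proof (induction k)
      case 0
      have "k0 powr t * V0 \<le> M" using M1 kV by linarith
      then have "V0 \<le> M / k0 powr t" using pos by (simp add: field_simps)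
      then show ?case by (simp add: V_0 P.prob_space)
    next
      case (Suc k)
      have mk: "m k - 1 = real k + k0" "m k = real (Suc k) + k0" by (auto simp: m_def)
      have "(\<integral>\<omega>. V (Suc k) \<omega> \<partial>P) \<le> M / m k powr t"
      proof (rule recursion_step[OF m1 _ a(2) t _ _ M0 M2])
        show "0 \<le> (\<integral>\<omega>. V k \<omega> \<partial>P)" using V0 by simp
        show "(\<integral>\<omega>. V k \<omega> \<partial>P) \<le> M / (m k - 1) powr t" using Suc mk by simp
      qed (use step[of k] Suc a in auto)
      then show ?case using step[of k] Suc unfolding mk(2) by blast
    qed
  qed
  with exists_M show ?thesis by blast
qed

end
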